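(* For each fixed integer $k\ge 5$, $$g(k,N)=O\bigl(\log_{(k-3)}N\bigr)\qquad\text{as } N\to\infty,$$ that is, there is a constant $C=C(k)$ such that $g(k,N)\le C\log_{(k-3)}N$ for all sufficiently large integers $N$.
   Context: A $k$-graph is a $k$-uniform hypergraph, and $K^{(k)}_n$ denotes the complete $k$-graph on $n$ vertices. For an integer $s\ge2$, an $s$-independent set in a $k$-graph $H$ is a set of vertices that is $K^{(k)}_s$-free (i.e. the sub-hypergraph of $H$ induced on it contains no copy of $K^{(k)}_s$); $\alpha_s(H)$ denotes the size of the largest $s$-independent set in $H$. For integers $k\le s<t<N$, the Erdős–Rogers function $f^{(k)}_{s,t}(N)$ is the minimum of $\alpha_s(H)$ taken over all $K^{(k)}_t$-free $k$-graphs $H$ on $N$ vertices. Write $g(k,N)=f^{(k)}_{k+1,k+2}(N)$. Here $\log_{(i)}$ denotes the logarithm function iterated $i$ times, and all logarithms are to base 2. *)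

theory Defs
  imports Complex_Main "HOL-Library.Ramsey" "HOL-Library.Landau_Symbols"
begin

text \<open>
  A hypergraph is given by its vertex set \<open>V\<close> and its edge set \<open>E\<close>.
  \<open>nsets A k\<close> is the set of all \<open>k\<close>-element subsets of \<open>A\<close>.
\<close>

definition kgraph :: "nat \<Rightarrow> 'a set \<Rightarrow> 'a set set \<Rightarrow> bool" where
  "kgraph k V E \<longleftrightarrow> finite V \<and> E \<subseteq> nsets V k"

text \<open>
  A copy of the complete \<open>k\<close>-graph on \<open>n\<close> vertices in \<open>(V, E)\<close> is an \<open>n\<close>-set of vertices
  all of whose \<open>k\<close>-subsets are edges; the copy need not be induced, but for a complete
  \<open>k\<close>-graph inside a \<open>k\<close>-graph this makes no difference.
\<close>

definition clique_free :: "nat \<Rightarrow> nat \<Rightarrow> 'a set \<Rightarrow> 'a set set \<Rightarrow> bool" where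
  "clique_free k n V E \<longleftrightarrow> \<not> (\<exists>T \<in> nsets V n. nsets T k \<subseteq> E)"

definition induced_edges :: "'a set set \<Rightarrow> 'a set \<Rightarrow> 'a set set" where
  "induced_edges E S = {e \<in> E. e \<subseteq> S}"

definition s_independent :: "nat \<Rightarrow> nat \<Rightarrow> 'a set \<Rightarrow> 'a set set \<Rightarrow> 'a set \<Rightarrow> bool" where
  "s_independent k s V E S \<longleftrightarrow> S \<subseteq> V \<and> clique_free k s S (induced_edges E S)"

definition alpha :: "nat \<Rightarrow> nat \<Rightarrow> 'a set \<Rightarrow> 'a set set \<Rightarrow> nat" where
  "alpha k s V E = Max (card ` {S. s_independent k s V E S})"

text \<open>
  Every finite hypergraph is isomorphic to one whose vertices are natural numbers, so it
  suffices to let \<open>V\<close> range over the \<open>N\<close>-element sets of naturals. For \<open>k \<le> s < t < N\<close> the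
  infimum is a minimum, by \<open>erdos_rogers_attained\<close> below.
\<close>

definition erdos_rogers :: "nat \<Rightarrow> nat \<Rightarrow> nat \<Rightarrow> nat \<Rightarrow> nat" where
  "erdos_rogers k s t N =
     Inf {alpha k s V E | (V :: nat set) E. kgraph k V E \<and> card V = N \<and> clique_free k t V E}"

definition g :: "nat \<Rightarrow> nat \<Rightarrow> nat" where
  "g k N = erdos_rogers k (k + 1) (k + 2) N"

text \<open>
  For fixed \<open>i\<close> this is the usual iterated logarithm once \<open>x\<close> is large; when an iterate is not
  positive the value depends on the library's convention for \<open>log\<close> and carries no meaning.
\<close>

definition iter_log :: "nat \<Rightarrow> real \<Rightarrow> real" where
  "iter_log i x = (log 2 ^^ i) x"

lemma alpha_attained:
  assumes "finite V" "1 \<le> s"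
  shows "\<exists>S. s_independent k s V E S \<and> card S = alpha k s V E"
proof -
  have "s_independent k s V E {}"
    using assms by (auto simp: s_independent_def clique_free_def nsets_def)
  moreover have "finite {S. s_independent k s V E S}"
    by (rule finite_subset[of _ "Pow V"]) (auto simp: s_independent_def assms)
  ultimately have "alpha k s V E \<in> card ` {S. s_independent k s V E S}"
    unfolding alpha_def by (intro Max_in) auto
  then show ?thesis by auto
qed

lemma erdos_rogers_attained:
  assumes "k \<le> t"
  shows "\<exists>(V :: nat set) E. kgraph k V E \<and> card V = N \<and> clique_free k t V E
           \<and> alpha k s V E = erdos_rogers k s t N"
proof -
  let ?A = "{alpha k s V E | (V :: nat set) E. kgraph k V E \<and> card V = N \<and> clique_free k t V E}"
  have "nsets T k \<noteq> {}" if "T \<in> nsets {..<N} t" for T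
  proof -
    from that have T: "finite T" "card T = t" by (auto simp: nsets_def)
    then obtain S where "S \<subseteq> T" "card S = k"
      using assms obtain_subset_with_card_n[of k T] by metis
    with T have "S \<in> nsets T k" by (auto simp: nsets_def intro: finite_subset)
    then show ?thesis by blast
  qed
  then have "clique_free k t {..<N} {}"
    by (auto simp: clique_free_def)
  then have "alpha k s {..<N} {} \<in> ?A"
    unfolding mem_Collect_eq
    by (intro exI[of _ "{..<N}"] exI[of _ "{}"]) (simp add: kgraph_def)
  then have "erdos_rogers k s t N \<in> ?A"
    unfolding erdos_rogers_def by (intro Inf_nat_def1) auto
  then obtain V :: "nat set" and E where "erdos_rogers k s t N = alpha k s V E"
    "kgraph k V E" "card V = N" "clique_free k t V E"
    by auto
  then show ?thesis by metis
qed

end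

theory Submission
  imports Defs
begin

text \<open>
  The proof steps up: from an \<open>r\<close>-graph \<open>\<phi>\<close> on \<open>M\<close> vertices it builds an \<open>(r + 1)\<close>-graph on
  \<open>2 ^ M\<close> vertices, while the size of the sets that are forced to contain the wanted clique
  grows only by a constant factor. Starting from a \<open>4\<close>-graph on \<open>N\<close> vertices in which every set of
  size \<open>O(log N)\<close> contains a \<open>5\<close>-clique but which has no \<open>6\<close>-clique, \<open>k - 4\<close> steps give the
  bound \<open>log_(k-3)\<close>.

  Numbers below \<open>2 ^ M\<close> are the leaves of a binary tree of depth \<open>M\<close>, and two leaves branch at the
  highest bit in which they differ. A set of leaves all of whose branchings split off a single
  leaf is a caterpillar; its set of branching levels has one element fewer and
  may be tested for membership in \<open>\<phi>\<close>. The new edges are of two kinds: caterpillars whose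
  levels form an edge of \<open>\<phi>\<close>, and sets whose top branching puts exactly \<open>2\<close> or \<open>3\<close> vertices on the
  low side. A large set of leaves contains either a long caterpillar, where cliques come from \<open>\<phi>\<close>,
  or a branching with many leaves on both sides, where \<open>3\<close> low and \<open>r - 1\<close> high leaves form a clique
  of split edges. Conversely, a clique on \<open>r + 3\<close> vertices made of split edges only cannot
  exist, because removing two vertices can change the size of the low side to a value other
  than \<open>2\<close> and \<open>3\<close>; and one made of caterpillar edges only would give an \<open>(r + 2)\<close>-clique
  of \<open>\<phi>\<close>.

  What remains are cliques that mix the two kinds. For these the induction carries, along with \<open>\<phi>\<close>,
  a family \<open>\<psi>\<close> of marked \<open>(r - 1)\<close>-sets. Every edge of \<open>\<phi>\<close> has, through each of its vertices, a
  marked subset, and every set of at least a constant number \<open>q\<close> of vertices has,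
  through each of its vertices, an unmarked subset. Split edges are
  required to contain no caterpillar with marked levels. The first property of \<open>\<psi>\<close> then
  rules out mixed cliques (\<open>mixed_clique_impossible\<close>), and the second ensures that
  enough split edges survive (\<open>step_clique_balanced\<close>). Both properties are inherited; the step
  is \<open>marked_step\<close>.

  The starting point \<open>marked_base\<close> is a random colouring of pairs. The colours are pairs of
  labels, and a set is an edge if its vertices can be labelled increasingly so that each
  pair of vertices is coloured by its labels. Since a colour determines the labels
  of both its vertices, a labelling of a clique is global and injective, so a clique has at most as
  many vertices as there are labels; a counting argument shows that some colouring has a
  fully labelled set inside every set of logarithmic size.
\<close>

section \<open>Branching of natural numbers by their binary digits\<close>

definition bit_gap :: "nat \<Rightarrow> nat \<Rightarrow> nat" where
  "bit_gap x y = (LEAST m. x div 2 ^ Suc m = y div 2 ^ Suc m)"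

lemma div_pow2_mono:
  fixes x y :: nat
  assumes "x div 2 ^ i = y div 2 ^ i" "i \<le> j"
  shows "x div 2 ^ j = y div 2 ^ j"
proof -
  have "z div 2 ^ j = (z div 2 ^ i) div 2 ^ (j - i)" for z :: nat
    using assms(2) by (simp add: div_mult2_eq[symmetric] power_add[symmetric])
  with assms(1) show ?thesis by simp
qed

text \<open>
  Agreement of all digits above a given position is preserved when the position is raised, so the
  least such position decides all of them.
\<close>

lemma bit_gap_le_iff: "bit_gap x y \<le> m \<longleftrightarrow> x div 2 ^ Suc m = y div 2 ^ Suc m"
proof
  have "x div 2 ^ Suc (max x y) = y div 2 ^ Suc (max x y)"
  proof -
    have "z < 2 ^ Suc (max x y)" if "z \<le> max x y" for z
      unfolding power_Suc using that less_exp[of "max x y"] by linarith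
    then show ?thesis by simp
  qed
  then have "x div 2 ^ Suc (bit_gap x y) = y div 2 ^ Suc (bit_gap x y)"
    unfolding bit_gap_def by (rule LeastI)
  moreover assume "bit_gap x y \<le> m"
  ultimately show "x div 2 ^ Suc m = y div 2 ^ Suc m"
    using div_pow2_mono Suc_le_mono by blast
next
  assume "x div 2 ^ Suc m = y div 2 ^ Suc m"
  then show "bit_gap x y \<le> m"
    unfolding bit_gap_def by (rule Least_le)
qed

lemma bit_gap_less_iff: "x \<noteq> y \<Longrightarrow> bit_gap x y < m \<longleftrightarrow> x div 2 ^ m = y div 2 ^ m"
  by (cases m) (use bit_gap_le_iff in \<open>auto simp: less_Suc_eq_le\<close>)

lemma bit_gap_sym: "bit_gap x y = bit_gap y x"
  unfolding bit_gap_def by (rule arg_cong[where f = Least]) auto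

lemma bit_gap_bound: "x \<noteq> y \<Longrightarrow> x < 2 ^ M \<Longrightarrow> y < 2 ^ M \<Longrightarrow> bit_gap x y < M"
  by (simp add: bit_gap_less_iff)

text \<open>
  The leaf set \<open>A \<union> B\<close> has its top branching at level \<open>m\<close>, with \<open>A\<close> and \<open>B\<close> on its two sides.
  The relation is symmetric in \<open>A\<close> and \<open>B\<close> and passes to nonempty subsets, which makes it more
  convenient than functions returning the two sides of a set.
\<close>

definition branches :: "nat \<Rightarrow> nat set \<Rightarrow> nat set \<Rightarrow> bool" where
  "branches m A B \<longleftrightarrow> A \<noteq> {} \<and> B \<noteq> {} \<and>
     (\<forall>x\<in>A. \<forall>y\<in>B. x \<noteq> y \<and> bit_gap x y = m) \<and>
     (\<forall>x\<in>A. \<forall>y\<in>A. x \<noteq> y \<longrightarrow> bit_gap x y < m) \<and>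
     (\<forall>x\<in>B. \<forall>y\<in>B. x \<noteq> y \<longrightarrow> bit_gap x y < m)"

lemma branches_sym: "branches m A B \<longleftrightarrow> branches m B A"
proof -
  have "branches m B A" if "branches m A B" for A B
    unfolding branches_def
  proof (intro conjI ballI impI)
    fix x y assume "x \<in> B" "y \<in> A"
    then show "x \<noteq> y" "bit_gap x y = m"
      using that bit_gap_sym[of x y] unfolding branches_def by auto
  qed (use that in \<open>auto simp: branches_def\<close>)
  then show ?thesis by blast
qed

lemma branches_mono:
  "branches m A B \<Longrightarrow> A' \<subseteq> A \<Longrightarrow> B' \<subseteq> B \<Longrightarrow> A' \<noteq> {} \<Longrightarrow> B' \<noteq> {} \<Longrightarrow> branches m A' B'"
  by (simp add: branches_def subset_iff)

lemma branchesD: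
  assumes "branches m A B"
  shows "A \<noteq> {}" "B \<noteq> {}"
    and "\<And>x y. x \<in> A \<Longrightarrow> y \<in> B \<Longrightarrow> x \<noteq> y"
    and "\<And>x y. x \<in> A \<Longrightarrow> y \<in> B \<Longrightarrow> bit_gap x y = m"
    and "\<And>x y. x \<in> A \<Longrightarrow> y \<in> A \<Longrightarrow> x \<noteq> y \<Longrightarrow> bit_gap x y < m"
    and "\<And>x y. x \<in> B \<Longrightarrow> y \<in> B \<Longrightarrow> x \<noteq> y \<Longrightarrow> bit_gap x y < m"
  using assms by (simp_all add: branches_def)

lemma branches_disjoint: "branches m A B \<Longrightarrow> A \<inter> B = {}"
  using branchesD(3) by blast

text \<open>
  Take \<open>m\<close> to be the highest position at which two elements differ. All elements agree above \<open>m\<close>,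
  so digit \<open>m\<close> separates them into two classes, and the class with digit \<open>0\<close> is the smaller one in
  the order of numbers.
\<close>

lemma branches_exist:
  assumes "finite e" "2 \<le> card e"
  obtains m A B where "e = A \<union> B" "branches m A B" "\<forall>x\<in>A. \<forall>y\<in>B. x < y"
proof -
  define P where "P = {(x, y). x \<in> e \<and> y \<in> e \<and> x \<noteq> y}"
  define m where "m = Max ((\<lambda>(x, y). bit_gap x y) ` P)"
  define A where "A = {x \<in> e. even (x div 2 ^ m)}"
  define B where "B = {x \<in> e. odd (x div 2 ^ m)}"
  have "finite P"
    by (rule finite_subset[of _ "e \<times> e"]) (auto simp: P_def assms)
  moreover have "P \<noteq> {}"
  proof -
    obtain x where "x \<in> e" using assms by fastforce
    moreover have "\<not> e \<subseteq> {x}" using assms card_mono[of "{x}" e] by auto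
    ultimately show ?thesis by (auto simp: P_def)
  qed
  ultimately have "m \<in> (\<lambda>(x, y). bit_gap x y) ` P"
    and le: "\<And>x y. x \<in> e \<Longrightarrow> y \<in> e \<Longrightarrow> x \<noteq> y \<Longrightarrow> bit_gap x y \<le> m"
    unfolding m_def by (auto intro!: Max_in Max_ge) (force simp: P_def)
  then obtain x y where xy: "x \<in> e" "y \<in> e" "x \<noteq> y" "bit_gap x y = m"
    by (auto simp: P_def)
  have agree: "x div 2 ^ m div 2 = y div 2 ^ m div 2" if "x \<in> e" "y \<in> e" for x y
    using le[OF that] unfolding bit_gap_le_iff power_Suc2 div_mult2_eq by (cases "x = y") auto
  have eq: "x div 2 ^ m = y div 2 ^ m"
    if "x \<in> e" "y \<in> e" "even (x div 2 ^ m) = even (y div 2 ^ m)" for x y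
    using agree[OF that(1,2)] that(3) by (metis div_mult_mod_eq even_iff_mod_2_eq_zero odd_iff_mod_2_eq_one)
  have "branches m A B"
    unfolding branches_def
  proof (intro conjI ballI impI)
    have ne: "even (x div 2 ^ m) \<noteq> even (y div 2 ^ m)"
      using eq[OF xy(1,2)] xy(3,4) bit_gap_less_iff[of x y m] by auto
    then show "A \<noteq> {}" "B \<noteq> {}"
      using xy(1,2) by (auto simp: A_def B_def)
  next
    fix x y assume *: "x \<in> A" "y \<in> B"
    then show "x \<noteq> y" by (auto simp: A_def B_def)
    then have "\<not> bit_gap x y < m"
      using * by (auto simp: bit_gap_less_iff A_def B_def)
    with le[of x y] * \<open>x \<noteq> y\<close> show "bit_gap x y = m" by (auto simp: A_def B_def)
  qed (auto simp: A_def B_def bit_gap_less_iff intro!: eq)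
  moreover have "x < y" if "x \<in> A" "y \<in> B" for x y
  proof (rule ccontr)
    assume "\<not> x < y"
    then have "y div 2 ^ m \<le> x div 2 ^ m" by (simp add: div_le_mono)
    moreover have "x div 2 ^ m div 2 = y div 2 ^ m div 2"
      using that agree by (auto simp: A_def B_def)
    moreover have "even (x div 2 ^ m)" "odd (y div 2 ^ m)"
      using that by (auto simp: A_def B_def)
    moreover have False if "v \<le> u" "u div 2 = v div 2" "even u" "odd v" for u v :: nat
      using that by presburger
    ultimately show False by blast
  qed
  moreover have "e = A \<union> B" by (auto simp: A_def B_def)
  ultimately show thesis using that by blast
qed

text \<open>
  Orienting a branching by the order of numbers makes it unique, so that the number of elements on
  the low side is a property of the set alone.
\<close>

lemma branches_unique:
  assumes "branches m A B" "branches m' A' B'" "A \<union> B = A' \<union> B'"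
    and "\<forall>x\<in>A. \<forall>y\<in>B. x < y" "\<forall>x\<in>A'. \<forall>y\<in>B'. x < y"
  shows "A = A' \<and> B = B'"
proof -
  have le: "bit_gap x y \<le> m" if "branches m A B" "x \<in> A \<union> B" "y \<in> A \<union> B" "x \<noteq> y" for x y m A B
    using that bit_gap_sym[of x y] unfolding branches_def by (metis Un_iff less_imp_le order_refl)
  have ex: "\<exists>x y. x \<in> A \<union> B \<and> y \<in> A \<union> B \<and> x \<noteq> y \<and> bit_gap x y = m" if "branches m A B" for m A B
    using that unfolding branches_def by blast
  have m: "m = m'"
    using le[OF assms(1)] le[OF assms(2)] ex[OF assms(1)] ex[OF assms(2)] assms(3)
    by (metis order_antisym)
  have A: "A = {x \<in> A \<union> B. \<exists>y\<in>A \<union> B. x < y \<and> bit_gap x y = m}"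
    if br: "branches m A B" and ord: "\<forall>x\<in>A. \<forall>y\<in>B. x < y" for m A B
  proof (intro equalityI subsetI)
    fix x assume "x \<in> {x \<in> A \<union> B. \<exists>y\<in>A \<union> B. x < y \<and> bit_gap x y = m}"
    then obtain y where "x \<in> A \<union> B" "y \<in> A \<union> B" "x < y" "bit_gap x y = m" by blast
    then show "x \<in> A"
      using br ord unfolding branches_def by (metis Un_iff less_not_sym)
  next
    fix x assume x: "x \<in> A"
    obtain y where y: "y \<in> B" using br unfolding branches_def by blast
    then have "x < y" "bit_gap x y = m" using x br ord unfolding branches_def by simp_all
    with x y show "x \<in> {x \<in> A \<union> B. \<exists>y\<in>A \<union> B. x < y \<and> bit_gap x y = m}"
      by blast
  qed
  have "A = A'" using A[OF assms(1,4)] A[OF assms(2,5)] m assms(3) by simp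
  moreover have "A \<inter> B = {}" "A' \<inter> B' = {}"
    using assms(1,2) branches_disjoint by auto
  ultimately show ?thesis using assms(3) by blast
qed

section \<open>Caterpillars\<close>

definition levels :: "nat set \<Rightarrow> nat set" where
  "levels e = {bit_gap x y | x y. x \<in> e \<and> y \<in> e \<and> x \<noteq> y}"

definition caterpillar :: "nat set \<Rightarrow> bool" where
  "caterpillar e \<longleftrightarrow> (\<forall>m A B. A \<union> B \<subseteq> e \<longrightarrow> branches m A B \<longrightarrow> card A = 1 \<or> card B = 1)"

lemma levels_mono: "e \<subseteq> f \<Longrightarrow> levels e \<subseteq> levels f"
  unfolding levels_def by blast

lemma levels_bound: "e \<subseteq> {..<2 ^ M} \<Longrightarrow> levels e \<subseteq> {..<M}"
  unfolding levels_def by (auto simp: subset_iff bit_gap_bound)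

lemma caterpillar_mono: "caterpillar f \<Longrightarrow> e \<subseteq> f \<Longrightarrow> caterpillar e"
  unfolding caterpillar_def
proof (intro allI impI)
  fix m A B
  assume *: "\<forall>m A B. A \<union> B \<subseteq> f \<longrightarrow> branches m A B \<longrightarrow> card A = 1 \<or> card B = 1" "e \<subseteq> f"
    and "A \<union> B \<subseteq> e" "branches m A B"
  then have "A \<union> B \<subseteq> f" by (rule_tac subset_trans)
  with *(1) \<open>branches m A B\<close> show "card A = 1 \<or> card B = 1" by simp
qed

lemma caterpillar_singleton: "caterpillar {x}"
  unfolding caterpillar_def
proof (intro allI impI)
  fix m A B assume "A \<union> B \<subseteq> {x}" "branches m A B"
  moreover from this have "A \<noteq> {}" by (simp add: branches_def)
  ultimately have "A = {x}" by blast
  then show "card A = 1 \<or> card B = 1" by simp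
qed

lemma caterpillarD:
  "caterpillar e \<Longrightarrow> branches m A B \<Longrightarrow> A \<union> B \<subseteq> e \<Longrightarrow> card A = 1 \<or> card B = 1"
  by (simp add: caterpillar_def)

lemma not_caterpillar:
  assumes "branches m A B" "A \<union> B \<subseteq> e" "2 \<le> card A" "2 \<le> card B"
  shows "\<not> caterpillar e"
  using caterpillarD[OF _ assms(1,2)] assms(3,4) by auto

text \<open>
  Any branching inside \<open>insert z r\<close> that involves \<open>z\<close> takes place at the top level \<open>m\<close>, because all
  elements of \<open>r\<close> are at distance \<open>m\<close> from \<open>z\<close>; hence \<open>z\<close> is alone on its side.
\<close>

lemma caterpillar_insert:
  assumes "branches m {z} r" "caterpillar r"
  shows "caterpillar (insert z r)"
proof -
  have *: "card A = 1" if br: "branches l A B" and AB: "A \<union> B \<subseteq> insert z r" and "z \<in> A" for l A B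
  proof -
    obtain y where y: "y \<in> B" using branchesD(2)[OF br] by blast
    then have "y \<noteq> z" "bit_gap z y = l"
      using branchesD(3,4)[OF br \<open>z \<in> A\<close>] by auto
    moreover from this have "bit_gap z y = m"
      using y AB branchesD(4)[OF assms(1), of z y] by auto
    ultimately have "l = m" by simp
    have "A = {z}"
    proof (rule ccontr)
      assume "A \<noteq> {z}"
      then obtain a where a: "a \<in> A" "a \<noteq> z" using \<open>z \<in> A\<close> by blast
      then have "bit_gap z a < l" using branchesD(5)[OF br \<open>z \<in> A\<close>] by simp
      moreover have "bit_gap z a = m" using a AB branchesD(4)[OF assms(1), of z a] by auto
      ultimately show False using \<open>l = m\<close> by simp
    qed
    then show ?thesis by simp
  qed
  show ?thesis
    unfolding caterpillar_def
  proof (intro allI impI)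
    fix l A B assume AB: "A \<union> B \<subseteq> insert z r" "branches l A B"
    consider "z \<in> A" | "z \<in> B" | "A \<union> B \<subseteq> r" using AB(1) by blast
    then show "card A = 1 \<or> card B = 1"
    proof cases
      case 1 then show ?thesis using *[OF AB(2,1)] by simp
    next
      case 2 then show ?thesis using *[of l B A] AB branches_sym[of l A B] by (simp add: Un_commute)
    next
      case 3 then show ?thesis using assms(2) AB(2) unfolding caterpillar_def by blast
    qed
  qed
qed

lemma levels_insert:
  assumes "branches m {z} r"
  shows "levels (insert z r) = insert m (levels r)" "\<And>l. l \<in> levels r \<Longrightarrow> l < m" "z \<notin> r" "r \<noteq> {}"
proof -
  have r: "r \<noteq> {}" "\<And>y. y \<in> r \<Longrightarrow> z \<noteq> y \<and> bit_gap z y = m \<and> bit_gap y z = m"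
    using branchesD[OF assms] bit_gap_sym by auto
  then show "levels (insert z r) = insert m (levels r)"
    unfolding levels_def by blast
  show "l < m" if "l \<in> levels r" for l
    using that branchesD(6)[OF assms] unfolding levels_def by blast
  show "z \<notin> r" using r(2) by blast
qed (rule branchesD(2)[OF assms])

text \<open>
  One side of the top branching of a caterpillar is a single leaf, so caterpillars are
  built from the bottom by adding one leaf above everything present. The levels are then distinct
  (\<open>card_levels\<close>), and each can be removed by removing the leaf attached to it
  (\<open>caterpillar_with_levels\<close>).
\<close>

lemma caterpillar_induct [consumes 3, case_names singleton insert]:
  assumes "finite e" "e \<noteq> {}" "caterpillar e"
    and single: "\<And>x. P {x}"
    and step: "\<And>z r m. branches m {z} r \<Longrightarrow> finite r \<Longrightarrow> r \<noteq> {} \<Longrightarrow> caterpillar r \<Longrightarrow> P r \<Longrightarrow> P (insert z r)"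
  shows "P e"
  using assms(1-3)
proof (induction "card e" arbitrary: e rule: less_induct)
  case less
  show ?case
  proof (cases "card e = 1")
    case True
    then show ?thesis using single by (auto simp: card_1_singleton_iff)
  next
    case False
    then have "2 \<le> card e" using less.prems card_gt_0_iff[of e] by linarith
    then obtain m A B where AB: "e = A \<union> B" "branches m A B"
      using branches_exist less.prems(1) by metis
    then have "card A = 1 \<or> card B = 1"
      using less.prems(3) unfolding caterpillar_def by blast
    then obtain z r where z: "e = insert z r" "branches m {z} r"
    proof
      assume "card A = 1"
      then show ?thesis using AB that by (auto simp: card_1_singleton_iff)
    next
      assume "card B = 1"
      then show ?thesis using AB that branches_sym[of m A B] by (auto simp: card_1_singleton_iff)
    qed
    then have "r \<noteq> {}" "z \<notin> r" using levels_insert[OF z(2)] by auto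
    have "finite r" "caterpillar r"
      using z less.prems caterpillar_mono[of e r] by auto
    moreover from this have "P r"
      using less.hyps[of r] z(1) \<open>r \<noteq> {}\<close> \<open>z \<notin> r\<close> by simp
    ultimately show ?thesis
      using step[OF z(2)] \<open>r \<noteq> {}\<close> z(1) by simp
  qed
qed

lemma finite_levels: "finite e \<Longrightarrow> finite (levels e)"
  by (rule finite_subset[of _ "(\<lambda>(x, y). bit_gap x y) ` (e \<times> e)"])
    (force simp: levels_def, simp)

lemma card_levels:
  assumes "finite e" "e \<noteq> {}" "caterpillar e"
  shows "card e = Suc (card (levels e))"
  using assms
proof (induction rule: caterpillar_induct)
  case (singleton x)
  then show ?case by (simp add: levels_def)
next
  case (insert z r m)
  then show ?case
    using levels_insert[OF insert(1)] finite_levels[of r] by (auto simp: card_insert_if)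
qed

lemma caterpillar_with_levels:
  assumes "finite e" "e \<noteq> {}" "caterpillar e" "D \<subseteq> levels e"
  shows "\<exists>f\<subseteq>e. f \<noteq> {} \<and> levels f = D"
  using assms
proof (induction arbitrary: D rule: caterpillar_induct)
  case (singleton x)
  then show ?case by (auto simp: levels_def)
next
  case (insert z r m)
  note li = levels_insert[OF insert.hyps(1)]
  have "D - {m} \<subseteq> levels r" using insert.prems li(1) by blast
  from insert.IH[OF this] obtain f where f: "f \<subseteq> r" "f \<noteq> {}" "levels f = D - {m}" by auto
  show ?case
  proof (cases "m \<in> D")
    case True
    have "branches m {z} f" using branches_mono[OF insert.hyps(1)] f by blast
    then have "levels (insert z f) = D" using levels_insert(1) f True by auto
    then show ?thesis using f by (intro exI[of _ "Set.insert z f"] conjI) auto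
  next
    case False
    then show ?thesis using f by (intro exI[of _ f] conjI) auto
  qed
qed

text \<open>
  A leaf survives as long as the level at which it hangs is kept. This transfers statements about
  all sets through a fixed level to statements about all caterpillars through a fixed
  leaf. For a leaf at the very bottom the lowest level serves.
\<close>

lemma caterpillar_with_levels_at:
  assumes "finite e" "2 \<le> card e" "caterpillar e" "x \<in> e"
  shows "\<exists>d\<in>levels e. \<forall>D. D \<subseteq> levels e \<longrightarrow> d \<in> D \<longrightarrow> (\<exists>f\<subseteq>e. x \<in> f \<and> levels f = D)"
proof -
  have "e \<noteq> {}" using assms by auto
  show ?thesis using assms(1) \<open>e \<noteq> {}\<close> assms(3,2,4)
  proof (induction rule: caterpillar_induct)
    case (insert z r m)
    note li = levels_insert[OF insert.hyps(1)]
    have add: "levels (Set.insert z f) = Set.insert m (levels f)" if "f \<subseteq> r" "f \<noteq> {}" for f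
      using that branches_mono[OF insert.hyps(1)] levels_insert(1) by blast
    consider "x = z" | "r = {x}" | "x \<in> r" "2 \<le> card r"
    proof -
      have "card r \<noteq> 0" using insert.hyps by simp
      moreover have "r = {x}" if "card r = 1" "x \<in> r"
        using that by (auto simp: card_1_singleton_iff)
      ultimately show ?thesis using that insert.prems(2) by (cases "2 \<le> card r") fastforce+
    qed
    then show ?case
    proof cases
      case 1
      have "\<exists>f\<subseteq>Set.insert z r. x \<in> f \<and> levels f = D"
        if D: "D \<subseteq> levels (Set.insert z r)" "m \<in> D" for D
      proof -
        have "D - {m} \<subseteq> levels r" using D li(1) by blast
        then obtain f where f: "f \<subseteq> r" "f \<noteq> {}" "levels f = D - {m}"
          using caterpillar_with_levels[of r "D - {m}"] insert.hyps by blast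
        then have "levels (Set.insert z f) = D" using add D by auto
        then show ?thesis using f 1 by (intro exI[of _ "Set.insert z f"] conjI) auto
      qed
      then show ?thesis using li(1) by blast
    next
      case 2
      then have "levels (Set.insert z r) = {m}" using li(1) by (auto simp: levels_def)
      then have "D = levels (Set.insert z r)" if "D \<subseteq> levels (Set.insert z r)" "m \<in> D" for D
        using that by auto
      then have "\<exists>f\<subseteq>Set.insert z r. x \<in> f \<and> levels f = D"
        if "D \<subseteq> levels (Set.insert z r)" "m \<in> D" for D
        using that 2 by (intro exI[of _ "Set.insert z r"] conjI) auto
      then show ?thesis using \<open>levels (Set.insert z r) = {m}\<close> by blast
    next
      case 3
      then obtain d where d: "d \<in> levels r"
        "\<And>D. D \<subseteq> levels r \<Longrightarrow> d \<in> D \<Longrightarrow> \<exists>f\<subseteq>r. x \<in> f \<and> levels f = D"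
        using insert.IH by metis
      have "\<exists>f\<subseteq>Set.insert z r. x \<in> f \<and> levels f = D"
        if D: "D \<subseteq> levels (Set.insert z r)" "d \<in> D" for D
      proof -
        have "d \<noteq> m" using li(2) d(1) by blast
        then have "D - {m} \<subseteq> levels r" "d \<in> D - {m}" using D li(1) by blast+
        then obtain f where f: "f \<subseteq> r" "x \<in> f" "levels f = D - {m}" using d(2) by metis
        show ?thesis
        proof (cases "m \<in> D")
          case True
          have "f \<noteq> {}" using f(2) by blast
          with True have "levels (Set.insert z f) = D" using add[of f] f(1,3) by auto
          then show ?thesis using f by (intro exI[of _ "Set.insert z f"] conjI) auto
        next
          case False
          then show ?thesis using f by (intro exI[of _ f] conjI) auto
        qed
      qed
      then show ?thesis using d(1) li(1) by blast
    qed
  qed auto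
qed

text \<open>
  Descending into the larger side at each branching loses at most a factor \<open>2\<close>; one leaf
  of the side that is left behind extends the caterpillar. If the larger side does not contain \<open>x\<close>,
  then \<open>x\<close> itself is that leaf.
\<close>

lemma large_caterpillar_at:
  assumes "finite S" "x \<in> S" "2 ^ d \<le> card S"
  shows "\<exists>e\<subseteq>S. caterpillar e \<and> x \<in> e \<and> d < card e"
  using assms
proof (induction d arbitrary: S x)
  case 0
  then show ?case using caterpillar_singleton[of x] by (intro exI[of _ "{x}"]) auto
next
  case (Suc d)
  have two: "(2::nat) ^ Suc d \<ge> 2" by simp
  then obtain m A B where AB: "S = A \<union> B" "branches m A B"
    using branches_exist[of S] Suc.prems by (metis le_trans)
  obtain A B where AB: "S = A \<union> B" "branches m A B" "x \<in> A"
  proof (cases "x \<in> A")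
    case True then show ?thesis using AB that by blast
  next
    case False then show ?thesis using AB that[of B A] Suc.prems(2) branches_sym by blast
  qed
  have fin: "finite A" "finite B" using AB Suc.prems by auto
  have ne: "A \<noteq> {}" "B \<noteq> {}" using branchesD(1,2)[OF AB(2)] by auto
  have "card S = card A + card B"
    using AB branches_disjoint fin by (metis card_Un_disjoint)
  then consider "2 ^ d \<le> card A" | "2 ^ d \<le> card B" using Suc.prems(3) by fastforce
  then obtain z r where zr: "branches m {z} r" "caterpillar r" "insert z r \<subseteq> S" "x \<in> insert z r" "d < card r"
  proof cases
    case 1
    obtain e where e: "e \<subseteq> A" "caterpillar e" "x \<in> e" "d < card e"
      using Suc.IH[OF fin(1) AB(3) 1] by blast
    obtain y where y: "y \<in> B" using ne by blast
    have "branches m B A" using AB(2) branches_sym by blast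
    then have "branches m {y} e" by (rule branches_mono) (use e y in auto)
    then show ?thesis using that e y AB(1) by blast
  next
    case 2
    obtain y where y: "y \<in> B" using ne by blast
    obtain e where e: "e \<subseteq> B" "caterpillar e" "y \<in> e" "d < card e"
      using Suc.IH[OF fin(2) y 2] by blast
    have "branches m {x} e" by (rule branches_mono[OF AB(2)]) (use e AB in auto)
    then show ?thesis using that e AB(1,3) by blast
  qed
  have "finite r" using finite_subset[OF zr(3) Suc.prems(1)] by simp
  then have "card (insert z r) = Suc (card r)"
    using card_insert_disjoint levels_insert(3)[OF zr(1)] by metis
  then have "Suc d < card (insert z r)" using zr(5) by simp
  then show ?case using zr(3,4) caterpillar_insert[OF zr(1,2)] by blast
qed

text \<open>
  If no branching has \<open>Q\<close> leaves on both sides, then following the larger side discards fewer than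
  \<open>Q\<close> leaves at each branching, and each branching contributes one leaf to a caterpillar. In contrast
  to \<open>large_caterpillar_at\<close> the length obtained is linear in the size of the set.
\<close>

lemma long_caterpillar:
  assumes "finite S" "S \<noteq> {}" "0 < Q"
    and "\<And>m A B. A \<union> B \<subseteq> S \<Longrightarrow> branches m A B \<Longrightarrow> \<forall>x\<in>A. \<forall>y\<in>B. x < y \<Longrightarrow> card A < Q \<or> card B < Q"
  shows "\<exists>e\<subseteq>S. e \<noteq> {} \<and> caterpillar e \<and> card S \<le> Q * card e"
  using assms
proof (induction "card S" arbitrary: S rule: less_induct)
  case less
  show ?case
  proof (cases "card S = 1")
    case True
    then obtain x where x: "S = {x}" by (auto simp: card_1_singleton_iff)
    then show ?thesis
      using caterpillar_singleton less.prems(3) by (intro exI[of _ S]) auto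
  next
    case False
    then have "2 \<le> card S" using less.prems card_gt_0_iff[of S] by linarith
    then obtain m A' B' where AB': "S = A' \<union> B'" "branches m A' B'" "\<forall>x\<in>A'. \<forall>y\<in>B'. x < y"
      using branches_exist[OF less.prems(1)] by metis
    then have "card A' < Q \<or> card B' < Q" using less.prems(4)[of A' B' m] by simp
    then obtain A B where AB: "S = A \<union> B" "branches m A B" "card A < Q"
      using AB'(1,2) branches_sym[of m A' B'] by (metis Un_commute)
    have fin: "finite A" "finite B" using AB less.prems by auto
    have ne: "A \<noteq> {}" "B \<noteq> {}" using branchesD(1,2)[OF AB(2)] by auto
    have card: "card S = card A + card B"
      using AB branches_disjoint fin by (metis card_Un_disjoint)
    have "card B < card S" using card ne fin by (simp add: card_gt_0_iff)
    moreover have "card C < Q \<or> card D < Q"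
      if "C \<union> D \<subseteq> B" "branches l C D" "\<forall>x\<in>C. \<forall>y\<in>D. x < y" for l C D
      using less.prems(4)[OF _ that(2,3)] that(1) AB(1) by blast
    ultimately obtain e where e: "e \<subseteq> B" "e \<noteq> {}" "caterpillar e" "card B \<le> Q * card e"
      using less.hyps[of B] fin(2) ne(2) less.prems(3) by auto
    obtain z where z: "z \<in> A" using ne by blast
    have br: "branches m {z} e" by (rule branches_mono[OF AB(2)]) (use e z in auto)
    have "finite e" using finite_subset[OF e(1) fin(2)] .
    then have "card (insert z e) = Suc (card e)" using card_insert_disjoint levels_insert(3)[OF br] by metis
    then have "card S \<le> Q * card (insert z e)" using card AB(3) e(4) by simp
    moreover have "insert z e \<subseteq> S" using e(1) z AB(1) by blast
    ultimately show ?thesis using caterpillar_insert[OF br e(3)] by blast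
  qed
qed

section \<open>Marked hypergraphs and the step from M to 2 ^ M vertices\<close>

text \<open>
  The invariant of the induction. The family \<open>\<psi>\<close> of marked sets is only consulted on sets of size
  \<open>r - 1\<close>. The last two conditions pull in opposite directions: marks are frequent enough to hit every
  edge of \<open>\<phi>\<close> in a subset through any given vertex, yet so rare that no set of \<open>q\<close> vertices has
  all its subsets through one vertex marked. The number \<open>q\<close> depends on \<open>r\<close> but not on \<open>N\<close>.
\<close>

definition marked :: "nat \<Rightarrow> nat \<Rightarrow> nat \<Rightarrow> nat \<Rightarrow> nat set set \<Rightarrow> nat set set \<Rightarrow> bool" where
  "marked r N n q \<phi> \<psi> \<longleftrightarrow> 0 < q \<and>
     \<phi> \<subseteq> nsets {..<N} r \<and> clique_free r (r + 2) {..<N} \<phi> \<and>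
     (\<forall>S\<subseteq>{..<N}. n \<le> card S \<longrightarrow> (\<exists>T\<in>nsets S (r + 1). nsets T r \<subseteq> \<phi>)) \<and>
     (\<forall>e\<in>\<phi>. \<forall>x\<in>e. \<exists>f\<in>nsets e (r - 1). x \<in> f \<and> f \<in> \<psi>) \<and>
     (\<forall>D\<subseteq>{..<N}. \<forall>x\<in>D. q \<le> card D \<longrightarrow> (\<exists>f\<in>nsets D (r - 1). x \<in> f \<and> f \<notin> \<psi>))"

text \<open>
  Allowing two consecutive sizes of the low side makes sets with \<open>3\<close> low and \<open>r - 1\<close> high vertices
  cliques; three consecutive sizes would admit cliques on \<open>r + 3\<close> vertices. The second
  conjunct separates split edges from caterpillar edges that share many vertices with them.
\<close>

definition split_edge :: "nat \<Rightarrow> nat set set \<Rightarrow> nat set \<Rightarrow> bool" where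
  "split_edge r \<psi> e \<longleftrightarrow>
     (\<exists>m A B. e = A \<union> B \<and> branches m A B \<and> (\<forall>x\<in>A. \<forall>y\<in>B. x < y) \<and> card A \<in> {2, 3}) \<and>
     (\<forall>f\<in>nsets e r. caterpillar f \<longrightarrow> levels f \<notin> \<psi>)"

definition step_edges :: "nat \<Rightarrow> nat \<Rightarrow> nat set set \<Rightarrow> nat set set \<Rightarrow> nat set set" where
  "step_edges r M \<phi> \<psi> =
     {e \<in> nsets {..<2 ^ M} (Suc r). (caterpillar e \<and> levels e \<in> \<phi>) \<or> split_edge r \<psi> e}"

text \<open>
  Sets that are no caterpillars are all marked. This costs nothing, since every large set contains
  large caterpillars through each of its elements.
\<close>

definition step_marks :: "nat set set \<Rightarrow> nat set set" where
  "step_marks \<psi> = {f. caterpillar f \<longrightarrow> levels f \<in> \<psi>}"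

lemma card_branches:
  "branches m A B \<Longrightarrow> finite (A \<union> B) \<Longrightarrow> card (A \<union> B) = card A + card B"
  using branches_disjoint by (simp add: card_Un_disjoint)

text \<open>
  The high side has at least \<open>r + 1 - 3 \<ge> 2\<close> elements, so the top branching of a split edge is
  balanced.
\<close>

lemma split_edge_not_caterpillar:
  assumes "4 \<le> r" "finite e" "card e = Suc r" "split_edge r \<psi> e"
  shows "\<not> caterpillar e"
proof -
  obtain m A B where AB: "e = A \<union> B" "branches m A B" "card A \<in> {2, 3}"
    using assms(4) unfolding split_edge_def by auto
  then have "card A + card B = Suc r" using card_branches[OF AB(2)] assms by simp
  then show ?thesis using not_caterpillar[OF AB(2)] AB(1,3) assms(1) by auto
qed

lemma step_edge_caterpillar:
  assumes "4 \<le> r" "e \<in> step_edges r M \<phi> \<psi>" "caterpillar e"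
  shows "levels e \<in> \<phi>"
proof -
  have "finite e" "card e = Suc r" using assms(2) by (auto simp: step_edges_def nsets_def)
  then show ?thesis
    using assms split_edge_not_caterpillar[of r e \<psi>] by (auto simp: step_edges_def)
qed

lemma step_edge_unbalanced:
  assumes "A \<union> B \<in> step_edges r M \<phi> \<psi>" "branches m A B" "\<forall>x\<in>A. \<forall>y\<in>B. x < y"
    and "card A \<notin> {2, 3}"
  shows "caterpillar (A \<union> B)" "levels (A \<union> B) \<in> \<phi>"
proof -
  have "\<not> split_edge r \<psi> (A \<union> B)"
  proof
    assume "split_edge r \<psi> (A \<union> B)"
    then obtain m' A' B' where "A \<union> B = A' \<union> B'" "branches m' A' B'"
      "\<forall>x\<in>A'. \<forall>y\<in>B'. x < y" "card A' \<in> {2, 3}"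
      unfolding split_edge_def by auto
    then show False using branches_unique[OF assms(2)] assms(3,4) by metis
  qed
  then show "caterpillar (A \<union> B)" "levels (A \<union> B) \<in> \<phi>"
    using assms(1) by (auto simp: step_edges_def)
qed

lemma contains_top:
  assumes "branches m {x} R" "f \<subseteq> insert x R" "m \<in> levels f"
  shows "x \<in> f"
proof (rule ccontr)
  assume "x \<notin> f"
  then have "f \<subseteq> R" using assms(2) by blast
  then have "m \<in> levels R" using assms(3) levels_mono by auto
  then show False using levels_insert(2)[OF assms(1)] by blast
qed

text \<open>
  Suppose a caterpillar edge \<open>insert x R\<close> lies in a clique that contains a second vertex \<open>x'\<close> on the
  side of \<open>x\<close>. Its levels form an edge of \<open>\<phi>\<close> and so contain a marked set through the top level \<open>m\<close>,
  which belongs to some \<open>f \<subseteq> insert x R\<close> with \<open>x \<in> f\<close>. Then \<open>insert x' f\<close> is an edge of neither kind: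
  it has two vertices on one side and at least two on the other, and it contains the
  caterpillar \<open>f\<close> with marked levels.
\<close>

lemma mixed_clique_impossible:
  assumes r: "4 \<le> r"
    and marks: "\<forall>e\<in>\<phi>. \<forall>x\<in>e. \<exists>f\<in>nsets e (r - 1). x \<in> f \<and> f \<in> \<psi>"
    and br: "branches m X R" and x: "x \<in> X" "x' \<in> X" "x \<noteq> x'" and fin: "finite R"
    and cat: "caterpillar (insert x R)" "levels (insert x R) \<in> \<phi>"
    and sub: "insert x R \<subseteq> T" "x' \<in> T"
    and clique: "nsets T (Suc r) \<subseteq> step_edges r M \<phi> \<psi>"
  shows False
proof -
  have bx: "branches m {x} R" using branches_mono[OF br] x branchesD(2)[OF br] by simp
  have "m \<in> levels (insert x R)" using levels_insert(1)[OF bx] by simp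
  then obtain F where F: "F \<in> nsets (levels (insert x R)) (r - 1)" "m \<in> F" "F \<in> \<psi>"
    using marks cat(2) by blast
  then have "F \<subseteq> levels (insert x R)" "card F = r - 1" by (auto simp: nsets_def)
  then obtain f where f: "f \<subseteq> insert x R" "f \<noteq> {}" "levels f = F"
    using caterpillar_with_levels[of "insert x R" F] fin cat(1) by auto
  have finf: "finite f" using finite_subset[OF f(1)] fin by simp
  have catf: "caterpillar f" using caterpillar_mono[OF cat(1) f(1)] .
  have cardf: "card f = r"
    using card_levels[OF finf f(2) catf] f(3) \<open>card F = r - 1\<close> r by simp
  have xf: "x \<in> f" using contains_top[OF bx f(1)] f(3) F(2) by simp
  have fR: "f - {x} \<subseteq> R" using f(1) by blast
  have cardfx: "card (f - {x}) = r - 1" using xf finf cardf by simp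
  then have "0 < card (f - {x})" using r by simp
  then have "f - {x} \<noteq> {}" by (auto simp only: card_gt_0_iff)
  then have br2: "branches m {x, x'} (f - {x})"
    using branches_mono[OF br _ fR] x by simp
  have "x' \<notin> f"
  proof
    assume "x' \<in> f"
    then have "x' \<in> R" using fR x(3) by blast
    then show False using branches_disjoint[OF br] x(2) by blast
  qed
  then have card: "card (insert x' f) = Suc r" using finf cardf by simp
  have "insert x' f \<subseteq> T" using f(1) sub by blast
  then have "insert x' f \<in> nsets T (Suc r)" using card finf by (simp add: nsets_def)
  then have E: "insert x' f \<in> step_edges r M \<phi> \<psi>" using clique by blast
  have "\<not> caterpillar (insert x' f)"
  proof (rule not_caterpillar[OF br2])
    show "{x, x'} \<union> (f - {x}) \<subseteq> insert x' f" using xf by blast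
  qed (use x(3) cardfx r in auto)
  then have "split_edge r \<psi> (insert x' f)" using E by (simp add: step_edges_def)
  moreover have "f \<in> nsets (insert x' f) r" using finf cardf by (auto simp: nsets_def)
  ultimately show False using catf f(3) F(3) by (auto simp: split_edge_def)
qed

lemma non_caterpillar_core:
  assumes "finite e" "\<not> caterpillar e"
  obtains m A B where "branches m A B" "A \<union> B \<subseteq> e" "card A = 2" "card B = 2"
proof -
  obtain m A B where AB: "A \<union> B \<subseteq> e" "branches m A B" "card A \<noteq> 1" "card B \<noteq> 1"
    using assms(2) unfolding caterpillar_def by auto
  have "finite A" "finite B" using AB(1) assms(1) finite_subset by auto
  moreover have "A \<noteq> {}" "B \<noteq> {}" using branchesD(1,2)[OF AB(2)] by auto
  ultimately have "card A \<noteq> 0" "card B \<noteq> 0" by auto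
  then have "2 \<le> card A" "2 \<le> card B" using AB(3,4) by auto
  then obtain A' B' where *: "A' \<subseteq> A" "card A' = 2" "B' \<subseteq> B" "card B' = 2"
    using obtain_subset_with_card_n by metis
  then have "A' \<noteq> {}" "B' \<noteq> {}" by auto
  then have "branches m A' B'" using branches_mono[OF AB(2)] * by simp
  then show thesis using that[of m A' B'] * AB(1) by auto
qed

text \<open>
  Let \<open>T\<close> have all its \<open>(r + 1)\<close>-subsets as edges, with \<open>A\<close> and \<open>B\<close> as the two sides of its top
  branching. If one side is a single vertex, a balanced branching on the other side could be completed
  to an edge with that vertex, which is neither split nor a caterpillar. If both sides have
  at least two vertices, two vertices can be removed so that the low side has a size
  other than \<open>2\<close> and \<open>3\<close>; the remaining set is a caterpillar edge, and the clique is mixed.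
\<close>

lemma step_clique_caterpillar:
  assumes r: "4 \<le> r" and T: "finite T" "card T = r + 3"
    and marks: "\<forall>e\<in>\<phi>. \<forall>x\<in>e. \<exists>f\<in>nsets e (r - 1). x \<in> f \<and> f \<in> \<psi>"
    and clique: "nsets T (Suc r) \<subseteq> step_edges r M \<phi> \<psi>"
  shows "caterpillar T"
proof (rule ccontr)
  assume ncat: "\<not> caterpillar T"
  have "2 \<le> card T" using T r by simp
  then obtain m A B where AB: "T = A \<union> B" "branches m A B" "\<forall>x\<in>A. \<forall>y\<in>B. x < y"
    using branches_exist[OF T(1)] by metis
  have fin: "finite A" "finite B" using AB(1) T(1) by auto
  have card: "card A + card B = r + 3" using card_branches[OF AB(2)] AB(1) T by simp
  have ne: "card A \<noteq> 0" "card B \<noteq> 0" using branchesD(1,2)[OF AB(2)] fin by auto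
  have edge: "caterpillar (A' \<union> B') \<and> levels (A' \<union> B') \<in> \<phi>"
    if "A' \<subseteq> A" "B' \<subseteq> B" "card A' \<notin> {0, 2, 3}" "card B' \<noteq> 0" "card A' + card B' = Suc r" for A' B'
  proof -
    have "A' \<noteq> {}" "B' \<noteq> {}" using that(3,4) by auto
    then have br: "branches m A' B'" using branches_mono[OF AB(2)] that(1,2) by simp
    have f: "finite (A' \<union> B')" using that(1,2) fin finite_subset by blast
    have "A' \<union> B' \<in> nsets T (Suc r)"
      using card_branches[OF br f] f that AB(1) by (auto simp: nsets_def)
    then have E: "A' \<union> B' \<in> step_edges r M \<phi> \<psi>" using clique by blast
    have "\<forall>x\<in>A'. \<forall>y\<in>B'. x < y" using AB(3) that(1,2) by blast
    moreover have "card A' \<notin> {2, 3}" using that(3) by blast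
    ultimately show ?thesis using step_edge_unbalanced[OF E br] by simp
  qed
  have single: "False"
    if br: "branches m {x} R" and T': "T = insert x R"
      and e: "\<And>R'. R' \<subseteq> R \<Longrightarrow> card R' = r \<Longrightarrow> caterpillar (insert x R')" for x R
  proof -
    have finR: "finite R" using T(1) T' by simp
    have cardR: "card R = r + 2" using T T' levels_insert(3)[OF br] finR by simp
    have "\<not> caterpillar R" using ncat caterpillar_insert[OF br] T' by blast
    then obtain l P Q where PQ: "branches l P Q" "P \<union> Q \<subseteq> R" "card P = 2" "card Q = 2"
      using non_caterpillar_core[OF finR] by metis
    have "card (P \<union> Q) = 4"
      using card_branches[OF PQ(1)] finite_subset[OF PQ(2) finR] PQ(3,4) by simp
    then obtain R' where R': "P \<union> Q \<subseteq> R'" "R' \<subseteq> R" "card R' = r"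
      using exists_subset_between[of "P \<union> Q" r R] PQ(2) finR r cardR by auto
    then have "P \<union> Q \<subseteq> insert x R'" by blast
    then show False using not_caterpillar[OF PQ(1)] PQ(3,4) e[OF R'(2,3)] by simp
  qed
  consider "card A = 1" | "card B = 1" | "2 \<le> card A" "2 \<le> card B" using ne by linarith
  then show False
  proof cases
    case 1
    then obtain x where x: "A = {x}" by (auto simp: card_1_singleton_iff)
    show False
    proof (rule single[of x B])
      fix R' assume "R' \<subseteq> B" "card R' = r"
      then show "caterpillar (insert x R')" using edge[of "{x}" R'] x r by simp
    qed (use AB x in auto)
  next
    case 2
    then obtain x where x: "B = {x}" by (auto simp: card_1_singleton_iff)
    show False
    proof (rule single[of x A])
      fix R' assume "R' \<subseteq> A" "card R' = r"
      then show "caterpillar (insert x R')" using edge[of R' "{x}"] x r by simp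
    qed (use AB x branches_sym[of m A B] in auto)
  next
    case 3
    \<comment> \<open>l is the size of the low side after the removal: 1 if A has at most 3 elements, else as small as possible but at least 4\<close>
    define l where "l = (if card A \<le> 3 then 1 else max 4 (card A - 2))"
    have l: "l \<le> card A" "l \<notin> {0, 2, 3}" "l < Suc r" "Suc r - l \<le> card B"
      using 3 card r by (auto simp: l_def)
    obtain A' B' where A': "A' \<subseteq> A" "card A' = l" and B': "B' \<subseteq> B" "card B' = Suc r - l"
      using obtain_subset_with_card_n[OF l(1)] obtain_subset_with_card_n[OF l(4)] by metis
    have ecat: "caterpillar (A' \<union> B')" "levels (A' \<union> B') \<in> \<phi>"
      using edge[of A' B'] A' B' l by auto
    have ne': "A' \<noteq> {}" "B' \<noteq> {}" using A' B' l by auto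
    then have br: "branches m A' B'" using branches_mono[OF AB(2)] A' B' by simp
    have fin': "finite A'" "finite B'" using finite_subset[OF A'(1) fin(1)] finite_subset[OF B'(1) fin(2)] by simp_all
    have mixed: False
      if "branches m X Y" "T = X \<union> Y" "X' \<subseteq> X" "Y' \<subseteq> Y" "finite Y'" "Y' \<noteq> {}" "2 \<le> card X" "card X' = 1"
        "caterpillar (X' \<union> Y')" "levels (X' \<union> Y') \<in> \<phi>" for X Y X' Y'
    proof -
      obtain x where x: "X' = {x}" using \<open>card X' = 1\<close> by (auto simp: card_1_singleton_iff)
      then have "x \<in> X" using that(3) by simp
      have "\<not> X \<subseteq> {x}" using that(7) card_mono[of "{x}" X] by auto
      then obtain x' where x': "x' \<in> X" "x' \<noteq> x" by blast
      have "branches m X Y'" using branches_mono[OF that(1)] that(4,6) branchesD(1)[OF that(1)] by simp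
      from mixed_clique_impossible[OF r marks this \<open>x \<in> X\<close> x'(1) _ that(5) _ _ _ _ clique]
      show False using x x' that(2,4,9,10) \<open>x \<in> X\<close> by auto
    qed
    have "card A' = 1 \<or> card B' = 1" using caterpillarD[OF ecat(1) br] by simp
    then show False
    proof
      assume "card A' = 1"
      then show False
        using mixed[OF AB(2,1) A'(1) B'(1) fin'(2) ne'(2) 3(1)] ecat by simp
    next
      assume "card B' = 1"
      moreover have "branches m B A" using AB(2) branches_sym by simp
      moreover have "T = B \<union> A" using AB(1) by (simp add: Un_commute)
      ultimately show False
        using mixed[of B A B' A'] A'(1) B'(1) fin'(1) ne'(1) 3(2) ecat by (simp add: Un_commute)
    qed
  qed
qed

lemma step_clique_free:
  assumes r: "4 \<le> r" and free: "clique_free r (r + 2) {..<M} \<phi>"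
    and marks: "\<forall>e\<in>\<phi>. \<forall>x\<in>e. \<exists>f\<in>nsets e (r - 1). x \<in> f \<and> f \<in> \<psi>"
  shows "clique_free (Suc r) (Suc r + 2) {..<2 ^ M} (step_edges r M \<phi> \<psi>)"
  unfolding clique_free_def
proof
  assume "\<exists>T\<in>nsets {..<2 ^ M} (Suc r + 2). nsets T (Suc r) \<subseteq> step_edges r M \<phi> \<psi>"
  then obtain T where T: "T \<subseteq> {..<2 ^ M}" "finite T" "card T = r + 3"
    and clique: "nsets T (Suc r) \<subseteq> step_edges r M \<phi> \<psi>"
    by (auto simp: nsets_def)
  have cat: "caterpillar T" by (rule step_clique_caterpillar[OF r T(2,3) marks clique])
  have "T \<noteq> {}" using T(3) by auto
  then have "levels T \<in> nsets {..<M} (r + 2)"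
    using card_levels[OF T(2) _ cat] T(3) levels_bound[OF T(1)] finite_levels[OF T(2)]
    by (auto simp: nsets_def)
  moreover have "D \<in> \<phi>" if D: "D \<in> nsets (levels T) r" for D
  proof -
    have D': "D \<subseteq> levels T" "card D = r" using D by (auto simp: nsets_def)
    obtain f where f: "f \<subseteq> T" "f \<noteq> {}" "levels f = D"
      using caterpillar_with_levels[OF T(2) \<open>T \<noteq> {}\<close> cat D'(1)] by auto
    have "finite f" using finite_subset[OF f(1) T(2)] .
    moreover have catf: "caterpillar f" using caterpillar_mono[OF cat f(1)] .
    ultimately have "f \<in> nsets T (Suc r)"
      using card_levels[of f] f D'(2) by (simp add: nsets_def)
    then show ?thesis using step_edge_caterpillar[OF r _ catf] clique f(3) by auto
  qed
  ultimately show False using free unfolding clique_free_def by blast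
qed

text \<open>
  In a caterpillar edge the marked subsets come from those of its levels. In a split edge one can
  drop a vertex other than \<open>x\<close> and keep two vertices on each side, and what remains is marked because
  it is no caterpillar.
\<close>

lemma step_marked_edges:
  assumes r: "4 \<le> r"
    and marks: "\<forall>e\<in>\<phi>. \<forall>x\<in>e. \<exists>f\<in>nsets e (r - 1). x \<in> f \<and> f \<in> \<psi>"
    and e: "e \<in> step_edges r M \<phi> \<psi>" "x \<in> e"
  shows "\<exists>f\<in>nsets e r. x \<in> f \<and> f \<in> step_marks \<psi>"
proof -
  have fe: "finite e" "card e = Suc r" using e(1) by (auto simp: step_edges_def nsets_def)
  show ?thesis
  proof (cases "caterpillar e")
    case True
    have "levels e \<in> \<phi>" by (rule step_edge_caterpillar[OF r e(1) True])
    have "2 \<le> card e" using fe r by simp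
    obtain d where d: "d \<in> levels e"
      "\<And>D. D \<subseteq> levels e \<Longrightarrow> d \<in> D \<Longrightarrow> \<exists>f\<subseteq>e. x \<in> f \<and> levels f = D"
      using caterpillar_with_levels_at[OF fe(1) \<open>2 \<le> card e\<close> True e(2)] by auto
    obtain F where F: "F \<in> nsets (levels e) (r - 1)" "d \<in> F" "F \<in> \<psi>"
      using marks \<open>levels e \<in> \<phi>\<close> d(1) by blast
    then have F': "F \<subseteq> levels e" "card F = r - 1" by (auto simp: nsets_def)
    obtain f where f: "f \<subseteq> e" "x \<in> f" "levels f = F" using d(2)[OF F'(1) F(2)] by auto
    have "finite f" "f \<noteq> {}" using finite_subset[OF f(1) fe(1)] f(2) by auto
    then have "card f = r"
      using card_levels[of f] caterpillar_mono[OF True f(1)] f(3) F'(2) r by simp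
    then have "f \<in> nsets e r" using f(1) \<open>finite f\<close> by (simp add: nsets_def)
    moreover have "f \<in> step_marks \<psi>" using f(3) F(3) by (simp add: step_marks_def)
    ultimately show ?thesis using f(2) by blast
  next
    case False
    then have "split_edge r \<psi> e" using e(1) by (simp add: step_edges_def)
    then obtain m A B where AB: "e = A \<union> B" "branches m A B" "card A \<in> {2, 3}"
      unfolding split_edge_def by auto
    have fin: "finite A" "finite B" using AB(1) fe(1) by auto
    have card: "card A + card B = Suc r" using card_branches[OF AB(2)] AB(1) fe by simp
    have other: "\<exists>y\<in>Y. y \<noteq> x" if "2 \<le> card Y" for Y
    proof -
      have "\<not> Y \<subseteq> {x}" using that card_mono[of "{x}" Y] by auto
      then show ?thesis by blast
    qed
    have "\<exists>y\<in>A \<union> B. y \<noteq> x \<and> 2 \<le> card (A - {y}) \<and> 2 \<le> card (B - {y})"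
    proof (cases "card A = 2")
      case True
      then have B: "3 \<le> card B" using card r by simp
      then obtain y where y: "y \<in> B" "y \<noteq> x" using other[of B] by auto
      then have "A - {y} = A" using branches_disjoint[OF AB(2)] by blast
      then show ?thesis using y True B fin by (intro bexI[of _ y]) auto
    next
      case False
      then have A: "card A = 3" and B: "2 \<le> card B" using AB(3) card r by auto
      then obtain y where y: "y \<in> A" "y \<noteq> x" using other[of A] by auto
      then have "B - {y} = B" using branches_disjoint[OF AB(2)] by blast
      then show ?thesis using y A B fin by (intro bexI[of _ y]) auto
    qed
    then obtain y where y: "y \<in> A \<union> B" "y \<noteq> x" "2 \<le> card (A - {y})" "2 \<le> card (B - {y})"
      by blast
    then have "0 < card (A - {y})" "0 < card (B - {y})" by linarith+
    then have "A - {y} \<noteq> {}" "B - {y} \<noteq> {}" by (auto simp only: card_gt_0_iff)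
    then have "branches m (A - {y}) (B - {y})" using branches_mono[OF AB(2)] by simp
    then have "\<not> caterpillar (e - {y})"
      by (rule not_caterpillar) (use y AB(1) in auto)
    then have "e - {y} \<in> step_marks \<psi>" by (simp add: step_marks_def)
    moreover have "e - {y} \<in> nsets e r" using fe y(1) AB(1) by (auto simp: nsets_def)
    ultimately show ?thesis using y(2) e(2) by (intro bexI[of _ "e - {y}"]) simp_all
  qed
qed

text \<open>
  The constant \<open>q\<close> grows to \<open>2 ^ q\<close>: that many leaves contain a caterpillar through \<open>x\<close> with at least
  \<open>q\<close> levels, and these levels have an unmarked subset through the level of \<open>x\<close>.
\<close>

lemma caterpillar_unmarked_at:
  assumes r: "2 \<le> r" and fin: "finite D" and x: "x \<in> D" and q: "0 < q" "2 ^ q \<le> card D"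
    and D: "D \<subseteq> {..<2 ^ M}"
    and unmarked: "\<forall>D\<subseteq>{..<M}. \<forall>x\<in>D. q \<le> card D \<longrightarrow> (\<exists>f\<in>nsets D (r - 1). x \<in> f \<and> f \<notin> \<psi>)"
  shows "\<exists>f\<in>nsets D r. x \<in> f \<and> f \<notin> step_marks \<psi>"
proof -
  obtain e where e: "e \<subseteq> D" "caterpillar e" "x \<in> e" "q < card e"
    using large_caterpillar_at[OF fin x q(2)] by auto
  have fe: "finite e" "e \<noteq> {}" using finite_subset[OF e(1) fin] e(3) by auto
  have "2 \<le> card e" using e(4) q(1) by simp
  obtain d where d: "d \<in> levels e"
    "\<And>F. F \<subseteq> levels e \<Longrightarrow> d \<in> F \<Longrightarrow> \<exists>f\<subseteq>e. x \<in> f \<and> levels f = F"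
    using caterpillar_with_levels_at[OF fe(1) \<open>2 \<le> card e\<close> e(2,3)] by auto
  have "q \<le> card (levels e)" using card_levels[OF fe e(2)] e(4) by simp
  moreover have "levels e \<subseteq> {..<M}" using levels_bound e(1) D by (metis order_trans)
  ultimately obtain F where F: "F \<in> nsets (levels e) (r - 1)" "d \<in> F" "F \<notin> \<psi>"
    using unmarked d(1) by blast
  then have F': "F \<subseteq> levels e" "card F = r - 1" by (auto simp: nsets_def)
  obtain f where f: "f \<subseteq> e" "x \<in> f" "levels f = F" using d(2)[OF F'(1) F(2)] by auto
  have ff: "finite f" "f \<noteq> {}" using finite_subset[OF f(1) fe(1)] f(2) by auto
  have cf: "caterpillar f" using caterpillar_mono[OF e(2) f(1)] .
  have "card f = r" using card_levels[OF ff cf] f(3) F'(2) r by simp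
  then have "f \<in> nsets D r" using ff(1) f(1) e(1) by (auto simp: nsets_def)
  moreover have "f \<notin> step_marks \<psi>" using cf f(3) F(3) by (simp add: step_marks_def)
  ultimately show ?thesis using f(2) by blast
qed

text \<open>
  A caterpillar inside \<open>Y\<close> together with one element of \<open>X\<close> has top level \<open>m\<close>. An unmarked set of
  levels through \<open>m\<close> yields \<open>H\<close>, and the levels of \<open>insert x H\<close> are the same for all \<open>x \<in> X\<close>.
\<close>

lemma unmarked_side:
  assumes r: "2 < r" and br: "branches m X Y" and fin: "finite Y" and q: "2 ^ q \<le> card Y"
    and bound: "X \<union> Y \<subseteq> {..<2 ^ M}"
    and unmarked: "\<forall>D\<subseteq>{..<M}. \<forall>x\<in>D. q \<le> card D \<longrightarrow> (\<exists>f\<in>nsets D (r - 1). x \<in> f \<and> f \<notin> \<psi>)"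
  shows "\<exists>H\<subseteq>Y. card H = r - 1 \<and> (\<forall>x\<in>X. levels (insert x H) \<notin> \<psi>)"
proof -
  obtain x y where x: "x \<in> X" and y: "y \<in> Y" using branchesD(1,2)[OF br] by blast
  obtain e where e: "e \<subseteq> Y" "caterpillar e" "y \<in> e" "q < card e"
    using large_caterpillar_at[OF fin y q] by auto
  have fe: "finite e" using finite_subset[OF e(1) fin] .
  have e_ne: "e \<noteq> {}" using e(3) by auto
  have bxe: "branches m {x} e" using branches_mono[OF br _ e(1)] x e_ne by simp
  let ?e = "insert x e"
  have cat: "caterpillar ?e" using caterpillar_insert[OF bxe e(2)] .
  have "card ?e = Suc (card e)" using fe levels_insert(3)[OF bxe] by simp
  then have "q \<le> card (levels ?e)" using card_levels[OF _ _ cat] fe e(4) by simp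
  moreover have "levels ?e \<subseteq> {..<M}"
  proof (rule levels_bound)
    show "?e \<subseteq> {..<2 ^ M}" using x e(1) bound by blast
  qed
  moreover have "m \<in> levels ?e" using levels_insert(1)[OF bxe] by simp
  ultimately obtain F where F: "F \<in> nsets (levels ?e) (r - 1)" "m \<in> F" "F \<notin> \<psi>"
    using unmarked by blast
  then have F': "F \<subseteq> levels ?e" "card F = r - 1" by (auto simp: nsets_def)
  obtain f where f: "f \<subseteq> ?e" "f \<noteq> {}" "levels f = F"
    using caterpillar_with_levels[OF _ _ cat F'(1)] fe by auto
  have ff: "finite f" using finite_subset[OF f(1)] fe by simp
  have cardf: "card f = r"
    using card_levels[OF ff f(2) caterpillar_mono[OF cat f(1)]] f(3) F'(2) r by simp
  have xf: "x \<in> f" using contains_top[OF bxe f(1)] f(3) F(2) by simp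
  define H where "H = f - {x}"
  have H: "H \<subseteq> Y" "card H = r - 1" using f(1) e(1) xf ff cardf by (auto simp: H_def)
  then have "0 < card H" using r by simp
  then have H_ne: "H \<noteq> {}" by (auto simp only: card_gt_0_iff)
  have lev: "levels (insert z H) = insert m (levels H)" if "z \<in> X" for z
    using levels_insert(1)[OF branches_mono[OF br _ H(1) _ H_ne, of "{z}"]] that by simp
  have "insert x H = f" using xf by (auto simp: H_def)
  then have "levels (insert z H) = F" if "z \<in> X" for z
    using lev[OF that] lev[OF x] f(3) by simp
  then show ?thesis using H F(3) by auto
qed

text \<open>
  The clique consists of three elements of \<open>A\<close> and \<open>r - 1\<close> elements of \<open>B\<close>, so that its
  \<open>(r + 1)\<close>-subsets have \<open>2\<close> or \<open>3\<close> elements in \<open>A\<close>. The only caterpillars of size \<open>r\<close> in it have a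
  single element on one side: either on the low side, with all of \<open>H\<close> above, or, if \<open>r = 4\<close>, on the high
  side, with all of \<open>L\<close> below. In both cases the levels are unmarked by the choice of \<open>H\<close> and \<open>L\<close>.
\<close>

lemma step_clique_balanced:
  assumes r: "4 \<le> r" and br: "branches m A B" and ord: "\<forall>x\<in>A. \<forall>y\<in>B. x < y"
    and fin: "finite A" "finite B" and q: "2 ^ q \<le> card A" "2 ^ q \<le> card B"
    and bound: "A \<union> B \<subseteq> {..<2 ^ M}"
    and unmarked: "\<forall>D\<subseteq>{..<M}. \<forall>x\<in>D. q \<le> card D \<longrightarrow> (\<exists>f\<in>nsets D (r - 1). x \<in> f \<and> f \<notin> \<psi>)"
  shows "\<exists>T\<in>nsets (A \<union> B) (r + 2). nsets T (Suc r) \<subseteq> step_edges r M \<phi> \<psi>"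
proof -
  have r2: "2 < r" using r by simp
  obtain H where H: "H \<subseteq> B" "card H = r - 1" "\<And>x. x \<in> A \<Longrightarrow> levels (insert x H) \<notin> \<psi>"
    using unmarked_side[OF r2 br fin(2) q(2) bound unmarked] by auto
  have br': "branches m B A" and bound': "B \<union> A \<subseteq> {..<2 ^ M}"
    using br branches_sym bound by (auto simp: Un_commute)
  obtain K where K: "K \<subseteq> A" "card K = r - 1" "\<And>y. y \<in> B \<Longrightarrow> levels (insert y K) \<notin> \<psi>"
    using unmarked_side[OF r2 br' fin(1) q(1) bound' unmarked] by auto
  \<comment> \<open>for r = 4 this makes L equal to K, whose choice then matters; for r > 4 any three low vertices would do\<close>
  have "3 \<le> card K" using K(2) r by simp
  then obtain L where L: "L \<subseteq> K" "card L = 3" by (rule obtain_subset_with_card_n)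
  have LA: "L \<subseteq> A" using L(1) K(1) by blast
  have finL: "finite L" "finite H"
    using finite_subset[OF LA fin(1)] finite_subset[OF H(1) fin(2)] by simp_all
  have "0 < card L" "0 < card H" using L(2) H(2) r by simp_all
  then have ne: "L \<noteq> {}" "H \<noteq> {}" by (auto simp only: card_gt_0_iff)
  have brLH: "branches m L H" using branches_mono[OF br LA H(1) ne] .
  have disj: "L \<inter> H = {}" using branches_disjoint[OF brLH] .
  have "L \<union> H \<in> nsets (A \<union> B) (r + 2)"
    using card_branches[OF brLH] finL L(2) H(1,2) LA r by (auto simp: nsets_def)
  moreover have "g \<in> step_edges r M \<phi> \<psi>" if g: "g \<in> nsets (L \<union> H) (Suc r)" for g
  proof -
    have g': "g \<subseteq> L \<union> H" "finite g" "card g = Suc r" using g by (auto simp: nsets_def)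
    have split: "card f = card (f \<inter> L) + card (f \<inter> H)" "f = (f \<inter> L) \<union> (f \<inter> H)"
      if "f \<subseteq> L \<union> H" for f
    proof -
      show "f = (f \<inter> L) \<union> (f \<inter> H)" using that by blast
      moreover have "(f \<inter> L) \<inter> (f \<inter> H) = {}" using disj by blast
      ultimately show "card f = card (f \<inter> L) + card (f \<inter> H)"
        using card_Un_disjoint[of "f \<inter> L" "f \<inter> H"] finL by simp
    qed
    have le: "card (f \<inter> L) \<le> 3" "card (f \<inter> H) \<le> r - 1" for f
      using card_mono[of L "f \<inter> L"] card_mono[of H "f \<inter> H"] finL L(2) H(2) by auto
    have cL: "card (g \<inter> L) \<in> {2, 3}" "0 < card (g \<inter> H)"
      using split(1)[OF g'(1)] le[of g] g'(3) r by auto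
    have "0 < card (g \<inter> L)" using cL(1) by auto
    then have ne': "g \<inter> L \<noteq> {}" "g \<inter> H \<noteq> {}" using cL(2) by (auto simp only: card_gt_0_iff)
    have brg: "branches m (g \<inter> L) (g \<inter> H)"
      using branches_mono[OF brLH _ _ ne'] by simp
    have ord': "\<forall>x\<in>g \<inter> L. \<forall>y\<in>g \<inter> H. x < y" using ord LA H(1) by blast
    have "levels f \<notin> \<psi>" if f: "f \<in> nsets g r" and cat: "caterpillar f" for f
    proof -
      have f': "f \<subseteq> L \<union> H" "card f = r" using f g'(1) by (auto simp: nsets_def)
      have sum: "card (f \<inter> L) + card (f \<inter> H) = r" using split(1)[OF f'(1)] f'(2) by simp
      have "0 < card (f \<inter> L)" "0 < card (f \<inter> H)" using sum le[of f] r by linarith+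
      then have "f \<inter> L \<noteq> {}" "f \<inter> H \<noteq> {}" by (auto simp only: card_gt_0_iff)
      then have "branches m (f \<inter> L) (f \<inter> H)" using branches_mono[OF brLH] by simp
      then consider "card (f \<inter> L) = 1" | "card (f \<inter> H) = 1"
        using caterpillarD[OF cat, of m "f \<inter> L" "f \<inter> H"] by blast
      then show ?thesis
      proof cases
        case 1
        then obtain x where x: "f \<inter> L = {x}" by (auto simp: card_1_singleton_iff)
        have "card (f \<inter> H) = card H" using sum 1 H(2) by simp
        then have "f \<inter> H = H" using card_subset_eq[OF finL(2), of "f \<inter> H"] by simp
        then have "f = insert x H" using split(2)[OF f'(1)] x by simp
        moreover have "x \<in> A" using x LA by blast
        ultimately show ?thesis using H(3) by simp
      next
        case 2
        then obtain y where y: "f \<inter> H = {y}" by (auto simp: card_1_singleton_iff)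
        have "card (f \<inter> L) = r - 1" using sum 2 by simp
        then have "r = 4" "card (f \<inter> L) = card L" using le(1)[of f] r L(2) by auto
        then have "f \<inter> L = L" using card_subset_eq[OF finL(1), of "f \<inter> L"] by simp
        moreover have "finite K" using finite_subset[OF K(1) fin(1)] .
        then have "L = K" using card_subset_eq[OF _ L(1)] L(2) K(2) \<open>r = 4\<close> by simp
        ultimately have "f = insert y K" using split(2)[OF f'(1)] y by simp
        moreover have "y \<in> B" using y H(1) by blast
        ultimately show ?thesis using K(3) by simp
      qed
    qed
    then have "split_edge r \<psi> g"
      unfolding split_edge_def using split(2)[OF g'(1)] brg ord' cL(1)
      by (intro conjI exI[of _ m] exI[of _ "g \<inter> L"] exI[of _ "g \<inter> H"]) auto
    moreover have "g \<subseteq> {..<2 ^ M}" using g'(1) LA H(1) bound by blast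
    ultimately show ?thesis using g' by (simp add: step_edges_def nsets_def)
  qed
  ultimately show ?thesis by blast
qed

lemma step_clique_chain:
  assumes r: "4 \<le> r" and e: "finite e" "e \<noteq> {}" "caterpillar e" "e \<subseteq> {..<2 ^ M}" "n < card e"
    and dense: "\<forall>S\<subseteq>{..<M}. n \<le> card S \<longrightarrow> (\<exists>T\<in>nsets S (r + 1). nsets T r \<subseteq> \<phi>)"
  shows "\<exists>T\<in>nsets e (r + 2). nsets T (Suc r) \<subseteq> step_edges r M \<phi> \<psi>"
proof -
  have "n \<le> card (levels e)" using card_levels[OF e(1-3)] e(5) by simp
  then obtain D where D: "D \<in> nsets (levels e) (r + 1)" "nsets D r \<subseteq> \<phi>"
    using dense levels_bound[OF e(4)] by blast
  then have D': "D \<subseteq> levels e" "card D = r + 1" "finite D" by (auto simp: nsets_def)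
  obtain f where f: "f \<subseteq> e" "f \<noteq> {}" "levels f = D"
    using caterpillar_with_levels[OF e(1-3) D'(1)] by auto
  have ff: "finite f" "caterpillar f"
    using finite_subset[OF f(1) e(1)] caterpillar_mono[OF e(3) f(1)] by auto
  have "card f = r + 2" using card_levels[OF ff(1) f(2) ff(2)] f(3) D'(2) by simp
  then have "f \<in> nsets e (r + 2)" using f(1) ff(1) by (simp add: nsets_def)
  moreover have "h \<in> step_edges r M \<phi> \<psi>" if h: "h \<in> nsets f (Suc r)" for h
  proof -
    have h': "h \<subseteq> f" "finite h" "card h = Suc r" using h by (auto simp: nsets_def)
    have cat: "caterpillar h" using caterpillar_mono[OF ff(2) h'(1)] .
    have "h \<noteq> {}" using h'(3) by auto
    then have "card (levels h) = r" using card_levels[OF h'(2) _ cat] h'(3) by simp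
    then have "levels h \<in> nsets D r"
      using levels_mono[OF h'(1)] f(3) finite_levels[OF h'(2)] by (simp add: nsets_def)
    then have "levels h \<in> \<phi>" using D(2) by blast
    moreover have "h \<subseteq> {..<2 ^ M}" using h'(1) f(1) e(4) by blast
    ultimately show ?thesis using cat h' by (simp add: step_edges_def nsets_def)
  qed
  ultimately show ?thesis by blast
qed

lemma step_dense:
  assumes r: "4 \<le> r"
    and dense: "\<forall>S\<subseteq>{..<M}. n \<le> card S \<longrightarrow> (\<exists>T\<in>nsets S (r + 1). nsets T r \<subseteq> \<phi>)"
    and unmarked: "\<forall>D\<subseteq>{..<M}. \<forall>x\<in>D. q \<le> card D \<longrightarrow> (\<exists>f\<in>nsets D (r - 1). x \<in> f \<and> f \<notin> \<psi>)"
    and S: "S \<subseteq> {..<2 ^ M}" "2 ^ q * n < card S"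
  shows "\<exists>T\<in>nsets S (r + 2). nsets T (Suc r) \<subseteq> step_edges r M \<phi> \<psi>"
proof -
  have finS: "finite S" using finite_subset[OF S(1)] by simp
  have sub: ?thesis if "R \<subseteq> S" "\<exists>T\<in>nsets R (r + 2). nsets T (Suc r) \<subseteq> step_edges r M \<phi> \<psi>" for R
    using that nsets_mono[OF that(1)] by blast
  show ?thesis
  proof (cases "\<exists>m A B. A \<union> B \<subseteq> S \<and> branches m A B \<and> (\<forall>x\<in>A. \<forall>y\<in>B. x < y) \<and> 2 ^ q \<le> card A \<and> 2 ^ q \<le> card B")
    case True
    then obtain m A B where AB: "A \<union> B \<subseteq> S" "branches m A B" "\<forall>x\<in>A. \<forall>y\<in>B. x < y"
      "2 ^ q \<le> card A" "2 ^ q \<le> card B" by auto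
    have "finite A" "finite B" using finite_subset[OF AB(1) finS] by auto
    moreover have "A \<union> B \<subseteq> {..<2 ^ M}" using AB(1) S(1) by (rule subset_trans)
    ultimately show ?thesis
      using sub[OF AB(1)] step_clique_balanced[OF r AB(2,3) _ _ AB(4,5) _ unmarked] by simp
  next
    case False
    have "S \<noteq> {}" using S(2) by auto
    have "card A < 2 ^ q \<or> card B < 2 ^ q"
      if "A \<union> B \<subseteq> S" "branches m A B" "\<forall>x\<in>A. \<forall>y\<in>B. x < y" for m A B
      using False that not_le by metis
    then obtain e where e: "e \<subseteq> S" "e \<noteq> {}" "caterpillar e" "card S \<le> 2 ^ q * card e"
      using long_caterpillar[OF finS \<open>S \<noteq> {}\<close>, of "2 ^ q"] by auto
    have "2 ^ q * n < 2 ^ q * card e" using e(4) S(2) by linarith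
    then have "n < card e" by simp
    moreover have "finite e" "e \<subseteq> {..<2 ^ M}" using e(1) finS S(1) finite_subset by auto
    ultimately show ?thesis
      using sub[OF e(1)] step_clique_chain[OF r _ e(2,3) _ _ dense] by simp
  qed
qed

lemma marked_step:
  assumes r: "4 \<le> r" and old: "marked r M n q \<phi> \<psi>"
  shows "marked (Suc r) (2 ^ M) (2 ^ q * n + 1) (2 ^ q) (step_edges r M \<phi> \<psi>) (step_marks \<psi>)"
proof -
  have q: "0 < q" and free: "clique_free r (r + 2) {..<M} \<phi>"
    and dense: "\<forall>S\<subseteq>{..<M}. n \<le> card S \<longrightarrow> (\<exists>T\<in>nsets S (r + 1). nsets T r \<subseteq> \<phi>)"
    and marks: "\<forall>e\<in>\<phi>. \<forall>x\<in>e. \<exists>f\<in>nsets e (r - 1). x \<in> f \<and> f \<in> \<psi>"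
    and unmarked: "\<forall>D\<subseteq>{..<M}. \<forall>x\<in>D. q \<le> card D \<longrightarrow> (\<exists>f\<in>nsets D (r - 1). x \<in> f \<and> f \<notin> \<psi>)"
    using old unfolding marked_def by blast+
  show ?thesis
    unfolding marked_def
  proof (intro conjI allI impI ballI)
    show "0 < (2::nat) ^ q" by simp
    show "step_edges r M \<phi> \<psi> \<subseteq> nsets {..<2 ^ M} (Suc r)" by (auto simp: step_edges_def)
    show "clique_free (Suc r) (Suc r + 2) {..<2 ^ M} (step_edges r M \<phi> \<psi>)"
      by (rule step_clique_free[OF r free marks])
  next
    fix S :: "nat set" assume "S \<subseteq> {..<2 ^ M}" "2 ^ q * n + 1 \<le> card S"
    then show "\<exists>T\<in>nsets S (Suc r + 1). nsets T (Suc r) \<subseteq> step_edges r M \<phi> \<psi>"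
      using step_dense[OF r dense unmarked] by simp
  next
    fix e x assume "e \<in> step_edges r M \<phi> \<psi>" "x \<in> e"
    then show "\<exists>f\<in>nsets e (Suc r - 1). x \<in> f \<and> f \<in> step_marks \<psi>"
      using step_marked_edges[OF r marks] by simp
  next
    fix D :: "nat set" and x assume D: "D \<subseteq> {..<2 ^ M}" "x \<in> D" "2 ^ q \<le> card D"
    have "finite D" using finite_subset[OF D(1)] by simp
    then show "\<exists>f\<in>nsets D (Suc r - 1). x \<in> f \<and> f \<notin> step_marks \<psi>"
      using caterpillar_unmarked_at[OF _ _ D(2) q D(3,1) unmarked] r by simp
  qed
qed

section \<open>Colourings of pairs with labelled sets in all large sets\<close>

text \<open>
  The sets consistent with \<open>\<chi>\<close>: an increasing labelling by numbers below \<open>L\<close> is read off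
  from the colours of the pairs.
\<close>

definition labelled :: "(nat \<times> nat \<Rightarrow> nat \<times> nat) \<Rightarrow> nat \<Rightarrow> nat set \<Rightarrow> bool" where
  "labelled \<chi> L e \<longleftrightarrow> (\<exists>l. (\<forall>u\<in>e. l u < L) \<and>
     (\<forall>u\<in>e. \<forall>v\<in>e. u < v \<longrightarrow> l u < l v \<and> \<chi> (u, v) = (l u, l v)))"

lemma labelled_mono: "labelled \<chi> L e \<Longrightarrow> f \<subseteq> e \<Longrightarrow> labelled \<chi> L f"
  unfolding labelled_def by (meson subsetD)

text \<open>
  A colour determines the labels of both ends of its pair. If all triples through \<open>m\<close> are labelled,
  the label of \<open>m\<close> is the same in all of them, the label of any other element is read off from
  its pair with \<open>m\<close>, and two elements obtain different labels because they lie in a common triple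
  with \<open>m\<close>. So \<open>D\<close> is labelled injectively by \<open>L\<close> labels.
\<close>

lemma card_labelled_star:
  assumes fin: "finite D" and m: "m \<in> D" and "3 \<le> card D"
    and star: "\<And>f. f \<in> nsets D 3 \<Longrightarrow> m \<in> f \<Longrightarrow> labelled \<chi> L f"
  shows "card D \<le> L"
proof -
  define other where "other a = (if m < a then snd (\<chi> (m, a)) else fst (\<chi> (a, m)))" for a
  define own where "own a = (if m < a then fst (\<chi> (m, a)) else snd (\<chi> (a, m)))" for a
  have triple: "other a < L \<and> own a < L \<and> own a = own b \<and> other a \<noteq> other b \<and> other a \<noteq> own a"
    if ab: "a \<in> D" "b \<in> D" "a \<noteq> m" "b \<noteq> m" "a \<noteq> b" for a b
  proof -
    have "{m, a, b} \<in> nsets D 3" using ab m by (auto simp: nsets_def)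
    then obtain l where l: "\<forall>u\<in>{m, a, b}. l u < L"
      "\<forall>u\<in>{m, a, b}. \<forall>v\<in>{m, a, b}. u < v \<longrightarrow> l u < l v \<and> \<chi> (u, v) = (l u, l v)"
      using star[of "{m, a, b}"] unfolding labelled_def by auto
    have inj: "l u \<noteq> l v" if "u \<in> {m, a, b}" "v \<in> {m, a, b}" "u \<noteq> v" for u v
      using l(2) that by (metis less_irrefl nat_neq_iff)
    have val: "other c = l c \<and> own c = l m" if "c \<in> {a, b}" for c
    proof (cases "m < c")
      case True
      then have "\<chi> (m, c) = (l m, l c)" using l(2) that by blast
      then show ?thesis using True by (simp add: other_def own_def)
    next
      case False
      then have "c < m" using that ab by auto
      then have "\<chi> (c, m) = (l c, l m)" using l(2) that by blast
      then show ?thesis using False by (simp add: other_def own_def)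
    qed
    show ?thesis using val[of a] val[of b] inj[of a b] inj[of a m] l(1) ab by simp
  qed
  have "\<exists>b\<in>D. b \<noteq> m \<and> b \<noteq> a" if "a \<in> D" for a
  proof (rule ccontr)
    assume "\<not> ?thesis"
    then have "D \<subseteq> {m, a}" by blast
    then have "card D \<le> card {m, a}" by (intro card_mono) auto
    also have "\<dots> \<le> 2" by (simp add: card_insert_if)
    finally show False using assms(3) by simp
  qed
  note pick = this
  obtain a0 where a0: "a0 \<in> D" "a0 \<noteq> m" using pick[OF m] by blast
  have own: "own a = own a0" "other a < L" "own a0 < L" "other a \<noteq> own a0" if a: "a \<in> D" "a \<noteq> m" for a
  proof -
    obtain b where b: "b \<in> D" "b \<noteq> m" "b \<noteq> a" using pick[OF a(1)] by blast
    have eq: "own a = own a0"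
      using triple[of a a0] a a0 by (cases "a = a0") auto
    show "own a = own a0" "other a < L" "own a0 < L" "other a \<noteq> own a0"
      using triple[of a b] a b eq by auto
  qed
  define \<nu> where "\<nu> u = (if u = m then own a0 else other u)" for u
  have "inj_on \<nu> D"
  proof (rule inj_onI)
    fix u v assume uv: "u \<in> D" "v \<in> D" "\<nu> u = \<nu> v"
    show "u = v"
    proof (rule ccontr)
      assume "u \<noteq> v"
      then consider "u = m" "v \<noteq> m" | "u \<noteq> m" "v = m" | "u \<noteq> m" "v \<noteq> m" by blast
      then show False
      proof cases
        case 1 then show ?thesis using uv own(4)[of v] by (simp add: \<nu>_def)
      next
        case 2 then show ?thesis using uv own(4)[of u] by (simp add: \<nu>_def)
      next
        case 3 then show ?thesis using uv triple[of u v] \<open>u \<noteq> v\<close> by (simp add: \<nu>_def)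
      qed
    qed
  qed
  moreover have "\<nu> ` D \<subseteq> {..<L}"
    using own(2) own(3)[OF a0] by (auto simp: \<nu>_def)
  ultimately have "card D \<le> card {..<L}" by (intro card_inj_on_le[of \<nu>]) auto
  then show ?thesis by simp
qed

text \<open>
  Among all functions from \<open>E\<close> to \<open>C\<close>, those that avoid a prescribed pattern on each of several disjoint
  sets of size \<open>P\<close> form a fraction of at most \<open>1 - 1 / card C ^ P\<close> to the power of the number of sets. This is
  independence, expressed by counting; the induction splits a function into its restrictions to
  one of the sets and to the rest.
\<close>

lemma card_avoiding_le:
  fixes X :: "'i \<Rightarrow> 'a set" and C :: "'b set"
  assumes "finite I" "finite C" "finite E"
    and "\<And>i. i \<in> I \<Longrightarrow> X i \<subseteq> E \<and> card (X i) = P \<and> t i \<in> X i \<rightarrow>\<^sub>E C"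
    and "\<And>i j. i \<in> I \<Longrightarrow> j \<in> I \<Longrightarrow> i \<noteq> j \<Longrightarrow> X i \<inter> X j = {}"
  shows "card {f \<in> E \<rightarrow>\<^sub>E C. \<forall>i\<in>I. restrict f (X i) \<noteq> t i} * (card C ^ P) ^ card I
    \<le> card C ^ card E * (card C ^ P - 1) ^ card I"
  using assms
proof (induction I arbitrary: E rule: finite_induct)
  case empty
  then show ?case by (simp add: card_PiE)
next
  case (insert i I)
  let ?Z = "card C ^ P"
  define E' where "E' = E - X i"
  define B where "B = {f \<in> E \<rightarrow>\<^sub>E C. \<forall>j\<in>insert i I. restrict f (X j) \<noteq> t j}"
  define B' where "B' = {f \<in> E' \<rightarrow>\<^sub>E C. \<forall>j\<in>I. restrict f (X j) \<noteq> t j}"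
  have Xi: "X i \<subseteq> E" "card (X i) = P" "t i \<in> X i \<rightarrow>\<^sub>E C" using insert.prems(3)[of i] by auto
  have finX: "finite (X i)" using Xi(1) insert.prems(2) by (rule finite_subset)
  have XE': "X j \<subseteq> E'" if "j \<in> I" for j
    using that insert.prems(3)[of j] insert.prems(4)[of i j] insert.hyps(2) by (auto simp: E'_def)
  have IH: "card B' * ?Z ^ card I \<le> card C ^ card E' * (?Z - 1) ^ card I"
    unfolding B'_def
    by (rule insert.IH) (use insert.prems XE' in \<open>auto simp: E'_def\<close>)
  let ?split = "\<lambda>f. (restrict f (X i), restrict f E')"
  have "inj_on ?split B"
  proof (rule inj_onI)
    fix f h assume fh: "f \<in> B" "h \<in> B" "?split f = ?split h"
    show "f = h"
    proof (rule PiE_ext)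
      show "f \<in> E \<rightarrow>\<^sub>E C" "h \<in> E \<rightarrow>\<^sub>E C" using fh by (auto simp: B_def)
      fix x assume "x \<in> E"
      then have "x \<in> X i \<or> x \<in> E'" by (auto simp: E'_def)
      then show "f x = h x" using fh(3) by (metis prod.inject restrict_apply)
    qed
  qed
  moreover have "?split ` B \<subseteq> ((X i \<rightarrow>\<^sub>E C) - {t i}) \<times> B'"
  proof (rule image_subsetI)
    fix f assume f: "f \<in> B"
    then have fE: "f \<in> E \<rightarrow>\<^sub>E C" by (auto simp: B_def)
    have "restrict f (X i) \<in> X i \<rightarrow>\<^sub>E C" "restrict f E' \<in> E' \<rightarrow>\<^sub>E C"
      using fE Xi(1) by (auto simp: E'_def)
    moreover have "restrict f (X i) \<noteq> t i" using f by (auto simp: B_def)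
    moreover have "restrict (restrict f E') (X j) \<noteq> t j" if "j \<in> I" for j
    proof -
      have "restrict (restrict f E') (X j) = restrict f (X j)"
        using XE'[OF that] by (auto simp: restrict_def fun_eq_iff)
      then show ?thesis using f that by (auto simp: B_def)
    qed
    ultimately show "?split f \<in> ((X i \<rightarrow>\<^sub>E C) - {t i}) \<times> B'" by (auto simp: B'_def)
  qed
  moreover have finB': "finite B'"
  proof (rule finite_subset)
    show "B' \<subseteq> E' \<rightarrow>\<^sub>E C" by (auto simp: B'_def)
    show "finite (E' \<rightarrow>\<^sub>E C)" using insert.prems(1,2) by (simp add: E'_def finite_PiE)
  qed
  moreover have "finite ((X i \<rightarrow>\<^sub>E C) - {t i})" using finX insert.prems(1) by (simp add: finite_PiE)
  ultimately have "card B \<le> card (((X i \<rightarrow>\<^sub>E C) - {t i}) \<times> B')"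
    by (intro card_inj_on_le[of ?split]) auto
  also have "\<dots> = (?Z - 1) * card B'"
    using Xi finX insert.prems(1) by (simp add: card_cartesian_product card_PiE card_Diff_singleton)
  finally have "card B \<le> (?Z - 1) * card B'" .
  then have "card B * ?Z ^ card (insert i I) \<le> (?Z - 1) * card B' * ?Z ^ card (insert i I)"
    by (rule mult_le_mono1)
  also have "\<dots> = (?Z - 1) * ?Z * (card B' * ?Z ^ card I)"
    using insert.hyps by (simp add: ac_simps)
  also have "\<dots> \<le> (?Z - 1) * ?Z * (card C ^ card E' * (?Z - 1) ^ card I)"
    using IH by (rule mult_le_mono2)
  also have "\<dots> = (card C ^ (P + card E')) * (?Z - 1) ^ card (insert i I)"
    using insert.hyps by (simp add: ac_simps power_add)
  also have "P + card E' = card E"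
    using Xi finX insert.prems(2) card_mono[OF insert.prems(2) Xi(1)] by (simp add: E'_def card_Diff_subset)
  finally show ?case unfolding B_def .
qed

text \<open>
  Many \<open>L\<close>-sets that pairwise share at most one element: positions are divided into \<open>L\<close> blocks of
  length \<open>L * q\<close>, and the line with parameters \<open>p = (a, b)\<close> meets block \<open>i\<close> at offset \<open>a + i * b\<close>. Two points
  determine the line, so there are \<open>q\<^sup>2\<close> lines without common pairs on \<open>L\<^sup>2 * q\<close> positions.
\<close>

definition line_point :: "nat \<Rightarrow> nat \<Rightarrow> nat \<times> nat \<Rightarrow> nat \<Rightarrow> nat" where
  "line_point L q p i = i * (L * q) + (fst p + i * snd p)"

lemma line_point_offset:
  fixes L q i :: nat
  assumes "p \<in> {..<q} \<times> {..<q}" "i < L"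
  shows "fst p + i * snd p < L * q"
proof -
  obtain a b where p: "p = (a, b)" "a < q" "b < q" using assms(1) by auto
  have "i * b \<le> (L - 1) * (q - 1)" using p assms(2) by (intro mult_le_mono) auto
  moreover have "L * q = (L - 1) * (q - 1) + (L - 1) + q"
    using p assms(2) by (cases L; cases q) auto
  ultimately show ?thesis using p(2) by (simp add: p(1))
qed

lemma line_point_less:
  assumes "p \<in> {..<q} \<times> {..<q}" "i < L"
  shows "line_point L q p i < L\<^sup>2 * q"
proof -
  have "line_point L q p i < Suc i * (L * q)"
    using line_point_offset[OF assms] by (simp add: line_point_def)
  also have "\<dots> \<le> L * (L * q)" using assms(2) by (intro mult_le_mono1) simp
  finally show ?thesis by (simp add: power2_eq_square)
qed

lemma line_point_strict_mono:
  assumes "p \<in> {..<q} \<times> {..<q}" "i < j" "j < L"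
  shows "line_point L q p i < line_point L q p j"
proof -
  have "line_point L q p i < Suc i * (L * q)"
    using line_point_offset[OF assms(1), of i L] assms(2,3) by (simp add: line_point_def)
  also have "\<dots> \<le> j * (L * q)" using assms(2) by (intro mult_le_mono1) simp
  finally show ?thesis by (simp add: line_point_def)
qed

lemma line_point_eq:
  assumes "p \<in> {..<q} \<times> {..<q}" "p' \<in> {..<q} \<times> {..<q}" "i < L" "i' < L"
    and "line_point L q p i = line_point L q p' i'"
  shows "i = i'" "fst p + i * snd p = fst p' + i * snd p'"
proof -
  have lt: "fst p + i * snd p < L * q" "fst p' + i' * snd p' < L * q"
    using line_point_offset[OF assms(1,3)] line_point_offset[OF assms(2,4)] by auto
  have pos: "0 < L * q" using lt(1) by linarith
  have div: "line_point L q p i div (L * q) = i"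
    using lt(1) pos unfolding line_point_def by (subst div_mult_self3) auto
  have div': "line_point L q p' i' div (L * q) = i'"
    using lt(2) pos unfolding line_point_def by (subst div_mult_self3) auto
  show "i = i'" using div div' assms(5) by simp
  then show "fst p + i * snd p = fst p' + i * snd p'"
    using assms(5) by (simp add: line_point_def)
qed

lemma lines_share_no_pair:
  assumes p: "p \<in> {..<q} \<times> {..<q}" "p' \<in> {..<q} \<times> {..<q}"
    and ij: "i < j" "j < L" "i' < j'" "j' < L"
    and eq: "line_point L q p i = line_point L q p' i'" "line_point L q p j = line_point L q p' j'"
  shows "p = p' \<and> i = i' \<and> j = j'"
proof -
  have "i < L" "i' < L" using ij by auto
  have i: "i = i'" "fst p + i * snd p = fst p' + i * snd p'"
    using line_point_eq[OF p \<open>i < L\<close> \<open>i' < L\<close> eq(1)] by auto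
  have j: "j = j'" "fst p + j * snd p = fst p' + j * snd p'"
    using line_point_eq[OF p ij(2,4) eq(2)] by auto
  have "int (fst p) + int i * int (snd p) = int (fst p') + int i * int (snd p')"
    "int (fst p) + int j * int (snd p) = int (fst p') + int j * int (snd p')"
    using i(2) j(2) by (simp_all flip: of_nat_mult of_nat_add)
  then have "(int j - int i) * (int (snd p) - int (snd p')) = 0"
    by (simp add: algebra_simps)
  then have "snd p = snd p'" using ij(1) by simp
  then show ?thesis using i j by (simp add: prod_eq_iff)
qed

text \<open>
  A fixed set \<open>S\<close> contains \<open>q\<^sup>2\<close> lines with disjoint sets of pairs. On each of them the pattern
  that labels the line by its block numbers must be avoided.
\<close>

lemma card_colorings_without_label:
  fixes q L :: nat and S :: "nat set"
  defines "J \<equiv> {(i, j). i < j \<and> j < L}"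
  defines "C \<equiv> {..<L} \<times> {..<L}"
  assumes S: "S \<subseteq> {..<N}" "card S = L\<^sup>2 * q"
  shows "card {\<chi> \<in> ({..<N} \<times> {..<N}) \<rightarrow>\<^sub>E C. \<not> (\<exists>T\<in>nsets S L. labelled \<chi> L T)} * (card C ^ card J) ^ q\<^sup>2
    \<le> card C ^ card ({..<N} \<times> {..<N}) * (card C ^ card J - 1) ^ q\<^sup>2"
proof -
  let ?E = "{..<N} \<times> {..<N}"
  let ?I = "{..<q} \<times> {..<q}"
  define s where "s k = sorted_list_of_set S ! k" for k
  have finS: "finite S" using finite_subset[OF S(1)] by simp
  have s_mem: "s k \<in> S" if "k < L\<^sup>2 * q" for k
    using that S(2) finS unfolding s_def
    by (metis nth_mem set_sorted_list_of_set sorted_list_of_set.length_sorted_key_list_of_set)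
  have s_mono: "s k < s l" if "k < l" "l < L\<^sup>2 * q" for k l
    using that S(2) sorted_wrt_nth_less[OF strict_sorted_list_of_set[of S], of k l]
    by (simp add: s_def)
  have s_inj: "k = l" if "s k = s l" "k < L\<^sup>2 * q" "l < L\<^sup>2 * q" for k l
    using s_mono that by (metis less_irrefl nat_neq_iff)
  define h where "h p = (\<lambda>(i, j). (s (line_point L q p i), s (line_point L q p j)))" for p
  define t where "t p = restrict (inv_into J (h p)) (h p ` J)" for p
  have J: "finite J" "J \<subseteq> C"
    unfolding J_def C_def by (auto intro: finite_subset[of _ "{..<L} \<times> {..<L}"])
  have h_eq: "p = p' \<and> ij = ij'"
    if p: "p \<in> ?I" "p' \<in> ?I" and ij: "ij \<in> J" "ij' \<in> J" and eq: "h p ij = h p' ij'" for p p' ij ij'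
  proof -
    obtain i j i' j' where ij': "ij = (i, j)" "i < j" "j < L" "ij' = (i', j')" "i' < j'" "j' < L"
      using ij by (auto simp: J_def)
    then have lt: "i < L" "i' < L" by auto
    have "line_point L q p i = line_point L q p' i'" "line_point L q p j = line_point L q p' j'"
      using eq ij' lt p by (auto simp: h_def intro!: s_inj line_point_less)
    then show ?thesis using lines_share_no_pair[OF p ij'(2,3,5,6)] ij' by simp
  qed
  have inj: "inj_on (h p) J" if "p \<in> ?I" for p
    using h_eq[OF that that] by (auto intro: inj_onI)
  have "card {f \<in> ?E \<rightarrow>\<^sub>E C. \<forall>p\<in>?I. restrict f (h p ` J) \<noteq> t p} * (card C ^ card J) ^ card ?I
    \<le> card C ^ card ?E * (card C ^ card J - 1) ^ card ?I"
  proof (rule card_avoiding_le)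
    show "finite ?I" "finite C" "finite ?E" by (simp_all add: C_def)
  next
    fix p assume p: "p \<in> ?I"
    have "h p ` J \<subseteq> ?E"
    proof (rule image_subsetI)
      fix ij assume "ij \<in> J"
      then obtain i j where ij: "ij = (i, j)" "i < L" "j < L" by (auto simp: J_def)
      then show "h p ij \<in> ?E"
        using s_mem[OF line_point_less[OF p ij(2)]] s_mem[OF line_point_less[OF p ij(3)]] S(1)
        by (auto simp: h_def)
    qed
    moreover have "card (h p ` J) = card J" using inj[OF p] by (rule card_image)
    moreover have "t p \<in> (h p ` J) \<rightarrow>\<^sub>E C"
      using J(2) inv_into_into[of _ "h p" J] by (auto simp: t_def)
    ultimately show "h p ` J \<subseteq> ?E \<and> card (h p ` J) = card J \<and> t p \<in> (h p ` J) \<rightarrow>\<^sub>E C" by simp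
  next
    fix p p' assume "p \<in> ?I" "p' \<in> ?I" "p \<noteq> p'"
    then show "h p ` J \<inter> h p' ` J = {}" using h_eq by blast
  qed
  moreover have "card {\<chi> \<in> ?E \<rightarrow>\<^sub>E C. \<not> (\<exists>T\<in>nsets S L. labelled \<chi> L T)}
    \<le> card {f \<in> ?E \<rightarrow>\<^sub>E C. \<forall>p\<in>?I. restrict f (h p ` J) \<noteq> t p}"
  proof (rule card_mono)
    show "finite {f \<in> ?E \<rightarrow>\<^sub>E C. \<forall>p\<in>?I. restrict f (h p ` J) \<noteq> t p}"
    proof (rule finite_subset)
      show "finite (?E \<rightarrow>\<^sub>E C)" by (simp add: C_def finite_PiE)
    qed blast
  next
    have found: "\<exists>T\<in>nsets S L. labelled \<chi> L T" if p: "p \<in> ?I" and eq: "restrict \<chi> (h p ` J) = t p" for \<chi> p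
    proof -
      let ?T = "(\<lambda>i. s (line_point L q p i)) ` {..<L}"
      have mono: "s (line_point L q p i) < s (line_point L q p j)" if "i < j" "j < L" for i j
        using s_mono line_point_strict_mono[OF p that] line_point_less[OF p that(2)] by simp
      have inj_s: "inj_on (\<lambda>i. s (line_point L q p i)) {..<L}"
        using mono by (intro inj_onI) (metis lessThan_iff less_irrefl nat_neq_iff)
      have val: "\<chi> (s (line_point L q p i), s (line_point L q p j)) = (i, j)" if "i < j" "j < L" for i j
      proof -
        have ij: "(i, j) \<in> J" using that by (simp add: J_def)
        then have "\<chi> (h p (i, j)) = restrict \<chi> (h p ` J) (h p (i, j))" by simp
        also have "\<dots> = inv_into J (h p) (h p (i, j))" using ij by (simp add: eq t_def)
        also have "\<dots> = (i, j)" using inv_into_f_f[OF inj[OF p] ij] .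
        finally show ?thesis by (simp add: h_def)
      qed
      let ?l = "inv_into {..<L} (\<lambda>i. s (line_point L q p i))"
      have l: "?l (s (line_point L q p i)) = i" if "i < L" for i
        using inv_into_f_f[OF inj_s] that by simp
      have "labelled \<chi> L ?T"
        unfolding labelled_def
      proof (intro exI[of _ ?l] conjI ballI impI)
        fix u assume "u \<in> ?T"
        then show "?l u < L" using l by auto
      next
        fix u v assume "u \<in> ?T" "v \<in> ?T" "u < v"
        then obtain i j where ij: "i < L" "j < L" "u = s (line_point L q p i)" "v = s (line_point L q p j)"
          by auto
        then have "i < j" using mono \<open>u < v\<close> by (metis less_asym less_irrefl nat_neq_iff)
        then show "?l u < ?l v" "\<chi> (u, v) = (?l u, ?l v)"
          using l ij val by simp_all
      qed
      moreover have "?T \<in> nsets S L"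
        using s_mem line_point_less[OF p] card_image[OF inj_s] by (auto simp: nsets_def)
      ultimately show ?thesis by blast
    qed
    show "{\<chi> \<in> ?E \<rightarrow>\<^sub>E C. \<not> (\<exists>T\<in>nsets S L. labelled \<chi> L T)}
      \<subseteq> {f \<in> ?E \<rightarrow>\<^sub>E C. \<forall>p\<in>?I. restrict f (h p ` J) \<noteq> t p}"
    proof (intro subsetI CollectI conjI ballI notI)
      fix \<chi> p
      assume "\<chi> \<in> {\<chi> \<in> ?E \<rightarrow>\<^sub>E C. \<not> (\<exists>T\<in>nsets S L. labelled \<chi> L T)}"
        and "p \<in> ?I" "restrict \<chi> (h p ` J) = t p"
      then show False using found[of p \<chi>] by blast
    qed blast
  qed
  ultimately show ?thesis
    by (simp add: power2_eq_square) (meson le_trans mult_le_mono1)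
qed

text \<open>
  Union bound over the at most \<open>N ^ (L\<^sup>2 * q)\<close> sets of size \<open>L\<^sup>2 * q\<close>. The number of lines in each is
  \<open>q\<^sup>2\<close>, so after taking \<open>q\<close>-th roots the condition becomes \<open>small\<close>.
\<close>

lemma labelling_coloring_exists:
  fixes L q N :: nat
  defines "Z \<equiv> (L * L) ^ card {(i, j). i < j \<and> j < L}"
  assumes q: "0 < q" and L: "0 < L" and small: "N ^ L\<^sup>2 * (Z - 1) ^ q < Z ^ q"
  shows "\<exists>\<chi>. \<forall>S\<subseteq>{..<N}. L\<^sup>2 * q \<le> card S \<longrightarrow> (\<exists>T\<in>nsets S L. labelled \<chi> L T)"
proof -
  let ?E = "{..<N} \<times> {..<N}" and ?C = "{..<L} \<times> {..<L}"
  define \<Omega> where "\<Omega> = ?E \<rightarrow>\<^sub>E ?C"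
  define bad where "bad S = {\<chi> \<in> \<Omega>. \<not> (\<exists>T\<in>nsets S L. labelled \<chi> L T)}" for S
  define F where "F = {S. S \<subseteq> {..<N} \<and> card S = L\<^sup>2 * q}"
  have fin: "finite \<Omega>" "finite F" by (auto simp: \<Omega>_def F_def finite_PiE)
  have card\<Omega>: "card \<Omega> = (L * L) ^ card ?E" "0 < card \<Omega>"
    using L by (simp_all add: \<Omega>_def card_PiE)
  have bad: "card (bad S) * Z ^ q\<^sup>2 \<le> card \<Omega> * (Z - 1) ^ q\<^sup>2" if "S \<in> F" for S
    using card_colorings_without_label[of S N L q] that card\<Omega>(1)
    by (simp add: bad_def F_def Z_def \<Omega>_def)
  have "card F = N choose (L\<^sup>2 * q)" unfolding F_def by (simp add: n_subsets)
  also have "\<dots> \<le> N ^ (L\<^sup>2 * q)"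
    by (cases "L\<^sup>2 * q \<le> N") (auto intro: binomial_le_pow simp: binomial_eq_0)
  finally have cardF: "card F \<le> N ^ (L\<^sup>2 * q)" .
  have "(\<Union>S\<in>F. bad S) \<noteq> \<Omega>"
  proof
    assume eq: "(\<Union>S\<in>F. bad S) = \<Omega>"
    have "card \<Omega> * Z ^ q\<^sup>2 \<le> (\<Sum>S\<in>F. card (bad S)) * Z ^ q\<^sup>2"
      using card_UN_le[OF fin(2), of bad] eq by simp
    also have "\<dots> = (\<Sum>S\<in>F. card (bad S) * Z ^ q\<^sup>2)" by (rule sum_distrib_right)
    also have "\<dots> \<le> (\<Sum>S\<in>F. card \<Omega> * (Z - 1) ^ q\<^sup>2)" by (rule sum_mono) (rule bad)
    also have "\<dots> = card F * (card \<Omega> * (Z - 1) ^ q\<^sup>2)" by simp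
    also have "\<dots> \<le> N ^ (L\<^sup>2 * q) * (card \<Omega> * (Z - 1) ^ q\<^sup>2)"
      using cardF by (rule mult_le_mono1)
    also have "\<dots> = card \<Omega> * (N ^ L\<^sup>2 * (Z - 1) ^ q) ^ q"
      by (simp add: power_mult power_mult_distrib power2_eq_square)
    also have "\<dots> < card \<Omega> * (Z ^ q) ^ q"
      using power_strict_mono[OF small _ q] card\<Omega>(2) by simp
    also have "\<dots> = card \<Omega> * Z ^ q\<^sup>2" by (simp add: power_mult power2_eq_square)
    finally show False by simp
  qed
  moreover have "(\<Union>S\<in>F. bad S) \<subseteq> \<Omega>" by (auto simp: bad_def)
  ultimately obtain \<chi> where \<chi>: "\<chi> \<in> \<Omega>" "\<And>S. S \<in> F \<Longrightarrow> \<chi> \<notin> bad S" by blast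
  have "\<exists>T\<in>nsets S L. labelled \<chi> L T" if S: "S \<subseteq> {..<N}" "L\<^sup>2 * q \<le> card S" for S
  proof -
    obtain R where R: "R \<subseteq> S" "card R = L\<^sup>2 * q" using obtain_subset_with_card_n[OF S(2)] by metis
    then have "R \<in> F" using S(1) by (auto simp: F_def)
    then have "\<exists>T\<in>nsets R L. labelled \<chi> L T" using \<chi> by (auto simp: bad_def)
    then show ?thesis using nsets_mono[OF R(1)] by blast
  qed
  then show ?thesis by blast
qed

text \<open>
  Since \<open>(1 - 1 / Z) ^ q \<le> exp (- q / Z)\<close>, it suffices that \<open>q\<close> exceeds \<open>Z * L\<^sup>2 * ln N\<close>. The summand
  \<open>2\<close> in \<open>K\<close> absorbs the rounding in \<open>q = n div L\<^sup>2\<close>.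
\<close>

lemma labelling_coloring_log:
  fixes L :: nat
  assumes L: "0 < L"
  shows "\<exists>K>0. \<forall>N\<ge>2. \<forall>n. K * log 2 (real N) \<le> real n \<longrightarrow>
    (\<exists>\<chi>. \<forall>S\<subseteq>{..<N}. n \<le> card S \<longrightarrow> (\<exists>T\<in>nsets S L. labelled \<chi> L T))"
proof -
  define Z where "Z = (L * L) ^ card {(i, j). i < j \<and> j < L}"
  have Z: "0 < Z" using L by (simp add: Z_def)
  define K where "K = real (L\<^sup>2) * (real Z * real (L\<^sup>2) + 2)"
  have "0 < K" using L by (simp add: K_def add_nonneg_pos)
  moreover have "\<exists>\<chi>. \<forall>S\<subseteq>{..<N}. n \<le> card S \<longrightarrow> (\<exists>T\<in>nsets S L. labelled \<chi> L T)"
    if N: "2 \<le> N" and n: "K * log 2 (real N) \<le> real n" for N n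
  proof -
    define q where "q = n div L\<^sup>2"
    have L2: "0 < L\<^sup>2" using L by simp
    have log1: "1 \<le> log 2 (real N)" using N by simp
    have ln_le: "ln (real N) \<le> log 2 (real N)"
    proof -
      have "ln (2::real) \<le> 1" using ln_le_minus_one[of "2::real"] by simp
      moreover have "0 \<le> ln (real N)" using N by simp
      moreover have "0 < ln (2::real)" by simp
      ultimately show ?thesis by (simp add: log_def field_simps mult_left_le)
    qed
    have "n < (q + 1) * L\<^sup>2"
      using L2 by (metis Suc_eq_plus1 dividend_less_times_div mult.commute mult_Suc_right q_def add.commute)
    then have "real n < (real q + 1) * real (L\<^sup>2)" by (metis of_nat_1 of_nat_add of_nat_less_iff of_nat_mult)
    with n have "(real Z * real (L\<^sup>2) + 2) * log 2 (real N) * real (L\<^sup>2) < (real q + 1) * real (L\<^sup>2)"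
      by (simp add: K_def mult.assoc mult.commute mult.left_commute)
    then have "(real Z * real (L\<^sup>2) + 2) * log 2 (real N) < real q + 1"
      using L2 by (simp only: mult_less_cancel_right)
    then have q1: "real Z * real (L\<^sup>2) * log 2 (real N) + 1 < real q"
      using log1 by (simp add: distrib_right)
    have nonneg: "0 \<le> real Z * real (L\<^sup>2) * log 2 (real N)"
      using log1 by simp
    then have "0 < q" using q1 by simp
    have "real Z * real (L\<^sup>2) * ln (real N) \<le> real Z * real (L\<^sup>2) * log 2 (real N)"
      using ln_le by (intro mult_left_mono) auto
    then have "real Z * (real (L\<^sup>2) * ln (real N)) < real q" using q1 by (simp add: mult.assoc)
    then have less: "real (L\<^sup>2) * ln (real N) < real q / real Z"
      using Z by (simp add: field_simps)
    have "real (N ^ L\<^sup>2) = exp (real (L\<^sup>2) * ln (real N))"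
      unfolding exp_of_nat_mult using N by simp
    also have "\<dots> < exp (real q / real Z)" using less by simp
    finally have NL: "real (N ^ L\<^sup>2) < exp (real q / real Z)" .
    have "1 - 1 / real Z \<le> exp (- 1 / real Z)" using exp_ge_add_one_self[of "- 1 / real Z"] by simp
    then have "(1 - 1 / real Z) ^ q \<le> exp (- 1 / real Z) ^ q" using Z by (intro power_mono) auto
    also have "\<dots> = exp (- (real q / real Z))" unfolding exp_of_nat_mult[symmetric] by simp
    finally have Zq: "(1 - 1 / real Z) ^ q \<le> exp (- (real q / real Z))" .
    have "real (N ^ L\<^sup>2) * (1 - 1 / real Z) ^ q < 1"
    proof -
      have "real (N ^ L\<^sup>2) * (1 - 1 / real Z) ^ q \<le> real (N ^ L\<^sup>2) * exp (- (real q / real Z))"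
        using Zq by (intro mult_left_mono) auto
      also have "\<dots> < exp (real q / real Z) * exp (- (real q / real Z))"
        using NL by (intro mult_strict_right_mono) auto
      also have "\<dots> = 1" by (simp add: exp_minus)
      finally show ?thesis .
    qed
    then have "real (N ^ L\<^sup>2) * (1 - 1 / real Z) ^ q * real Z ^ q < 1 * real Z ^ q"
      using Z by (intro mult_strict_right_mono) auto
    moreover have "(1 - 1 / real Z) ^ q * real Z ^ q = real (Z - 1) ^ q"
      using Z by (simp add: of_nat_diff field_simps flip: power_mult_distrib)
    ultimately have "real (N ^ L\<^sup>2 * (Z - 1) ^ q) < real (Z ^ q)" by (simp add: mult.assoc)
    then have "N ^ L\<^sup>2 * (Z - 1) ^ q < Z ^ q" by (simp only: of_nat_less_iff)
    from labelling_coloring_exists[OF \<open>0 < q\<close> L, of N, folded Z_def, OF this]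
    obtain \<chi> where \<chi>: "\<forall>S\<subseteq>{..<N}. L\<^sup>2 * q \<le> card S \<longrightarrow> (\<exists>T\<in>nsets S L. labelled \<chi> L T)"
      by (elim exE)
    have "L\<^sup>2 * q \<le> n" by (simp add: q_def)
    then show ?thesis using \<chi> by (intro exI[of _ \<chi>]) simp
  qed
  ultimately show ?thesis by blast
qed

text \<open>
  With \<open>r + 1\<close> labels, edges and marked sets are the labelled \<open>r\<close>-sets and \<open>(r - 1)\<close>-sets. As \<open>r - 1 \<ge> 3\<close>,
  a set all of whose \<open>(r - 1)\<close>-subsets through one vertex are labelled has all its triples through that
  vertex labelled, hence at most \<open>r + 1\<close> elements. This gives both the absence of \<open>(r + 2)\<close>-cliques and
  the rarity of marks.
\<close>

lemma marked_base:
  fixes r :: nat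
  assumes r: "4 \<le> r"
  shows "\<exists>K>0. \<forall>N\<ge>2. \<forall>n. K * log 2 (real N) \<le> real n \<longrightarrow> (\<exists>\<phi> \<psi>. marked r N n (r + 2) \<phi> \<psi>)"
proof -
  obtain K where K: "0 < K" "\<And>N n. 2 \<le> N \<Longrightarrow> K * log 2 (real N) \<le> real n \<Longrightarrow>
      \<exists>\<chi>. \<forall>S\<subseteq>{..<N}. n \<le> card S \<longrightarrow> (\<exists>T\<in>nsets S (r + 1). labelled \<chi> (r + 1) T)"
    using labelling_coloring_log[of "r + 1"] by auto
  have "\<exists>\<phi> \<psi>. marked r N n (r + 2) \<phi> \<psi>" if Nn: "2 \<le> N" "K * log 2 (real N) \<le> real n" for N n
  proof -
    obtain \<chi> where \<chi>: "\<And>S. S \<subseteq> {..<N} \<Longrightarrow> n \<le> card S \<Longrightarrow> \<exists>T\<in>nsets S (r + 1). labelled \<chi> (r + 1) T"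
      using K(2)[OF Nn] by auto
    define \<phi> where "\<phi> = {e \<in> nsets {..<N} r. labelled \<chi> (r + 1) e}"
    define \<psi> where "\<psi> = {f. labelled \<chi> (r + 1) f}"
    have unlabelled: "\<exists>f\<in>nsets D s. x \<in> f \<and> f \<notin> \<psi>"
      if D: "finite D" "x \<in> D" "r + 2 \<le> card D" and s: "3 \<le> s" "s \<le> r" for D x s
    proof (rule ccontr)
      assume neg: "\<not> ?thesis"
      have "card D \<le> r + 1"
      proof (rule card_labelled_star[OF D(1,2)])
        show "3 \<le> card D" using D(3) r by simp
        fix f assume f: "f \<in> nsets D 3" "x \<in> f"
        then have "f \<subseteq> D" "card f = 3" by (auto simp: nsets_def)
        then obtain h where h: "f \<subseteq> h" "h \<subseteq> D" "card h = s"
          using exists_subset_between[of f s D] D s by auto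
        moreover have "finite h" using finite_subset[OF h(2) D(1)] .
        ultimately have "h \<in> nsets D s" "x \<in> h" using f(2) by (auto simp: nsets_def)
        then have "labelled \<chi> (r + 1) h" using neg by (auto simp: \<psi>_def)
        then show "labelled \<chi> (r + 1) f" using labelled_mono h(1) by blast
      qed
      then show False using D(3) by simp
    qed
    have "marked r N n (r + 2) \<phi> \<psi>"
      unfolding marked_def
    proof (intro conjI allI impI ballI)
      show "\<phi> \<subseteq> nsets {..<N} r" by (auto simp: \<phi>_def)
      show "clique_free r (r + 2) {..<N} \<phi>"
        unfolding clique_free_def
      proof
        assume "\<exists>T\<in>nsets {..<N} (r + 2). nsets T r \<subseteq> \<phi>"
        then obtain T where T: "finite T" "card T = r + 2" "nsets T r \<subseteq> \<phi>"
          by (auto simp: nsets_def)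
        then obtain x where "x \<in> T" by fastforce
        then show False using unlabelled[OF T(1), of x r] T r by (auto simp: \<phi>_def \<psi>_def)
      qed
    next
      fix S assume S: "S \<subseteq> {..<N}" "n \<le> card S"
      then obtain T where T: "T \<in> nsets S (r + 1)" "labelled \<chi> (r + 1) T" using \<chi> by blast
      have "nsets T r \<subseteq> \<phi>"
      proof
        fix e assume e: "e \<in> nsets T r"
        then have "e \<subseteq> T" by (auto simp: nsets_def)
        moreover have "T \<subseteq> {..<N}" using T(1) S(1) by (auto simp: nsets_def)
        ultimately show "e \<in> \<phi>"
          using e labelled_mono[OF T(2)] by (auto simp: \<phi>_def nsets_def)
      qed
      then show "\<exists>T\<in>nsets S (r + 1). nsets T r \<subseteq> \<phi>" using T(1) by blast
    next
      fix e x assume e: "e \<in> \<phi>" "x \<in> e"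
      then have e': "finite e" "card e = r" "labelled \<chi> (r + 1) e" by (auto simp: \<phi>_def nsets_def)
      obtain f where f: "{x} \<subseteq> f" "f \<subseteq> e" "card f = r - 1"
      proof -
        have "card {x} \<le> r - 1" "r - 1 \<le> card e" "{x} \<subseteq> e" using r e(2) e'(2) by auto
        from exists_subset_between[OF this e'(1)] show thesis using that by auto
      qed
      then have "f \<in> nsets e (r - 1)" "f \<in> \<psi>"
        using finite_subset[OF f(2) e'(1)] labelled_mono[OF e'(3) f(2)] by (auto simp: nsets_def \<psi>_def)
      then show "\<exists>f\<in>nsets e (r - 1). x \<in> f \<and> f \<in> \<psi>" using f(1) by blast
    next
      fix D :: "nat set" and x assume D: "D \<subseteq> {..<N}" "x \<in> D" "r + 2 \<le> card D"
      then show "\<exists>f\<in>nsets D (r - 1). x \<in> f \<and> f \<notin> \<psi>"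
        using unlabelled[of D x "r - 1"] finite_subset[OF D(1)] r by simp
    qed simp
    then show ?thesis by blast
  qed
  then show ?thesis using K(1) by blast
qed

section \<open>Iterated logarithms and the bound\<close>

lemma marked_mono:
  assumes old: "marked r N n q \<phi> \<psi>" and le: "N' \<le> N" "n \<le> n'"
  shows "marked r N' n' q (\<phi> \<inter> nsets {..<N'} r) \<psi>"
proof -
  have sub: "{..<N'} \<subseteq> {..<N}" using le(1) by auto
  have free: "clique_free r (r + 2) {..<N} \<phi>"
    and dense: "\<And>S. S \<subseteq> {..<N} \<Longrightarrow> n \<le> card S \<Longrightarrow> \<exists>T\<in>nsets S (r + 1). nsets T r \<subseteq> \<phi>"
    and unmarked: "\<And>D x. D \<subseteq> {..<N} \<Longrightarrow> x \<in> D \<Longrightarrow> q \<le> card D \<Longrightarrow>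
      \<exists>f\<in>nsets D (r - 1). x \<in> f \<and> f \<notin> \<psi>"
    using old unfolding marked_def by simp_all
  have dense': "\<exists>T\<in>nsets S (r + 1). nsets T r \<subseteq> \<phi> \<inter> nsets {..<N'} r"
    if S: "S \<subseteq> {..<N'}" "n' \<le> card S" for S
  proof -
    have "S \<subseteq> {..<N}" "n \<le> card S" using S sub le(2) by auto
    from dense[OF this] obtain T where T: "T \<in> nsets S (r + 1)" "nsets T r \<subseteq> \<phi>" by blast
    have "T \<subseteq> {..<N'}" using T(1) S(1) by (auto simp: nsets_def)
    then have "nsets T r \<subseteq> nsets {..<N'} r" by (rule nsets_mono)
    then show ?thesis using T by (intro bexI[of _ T]) simp_all
  qed
  have free': "clique_free r (r + 2) {..<N'} (\<phi> \<inter> nsets {..<N'} r)"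
    unfolding clique_free_def
  proof
    assume "\<exists>T\<in>nsets {..<N'} (r + 2). nsets T r \<subseteq> \<phi> \<inter> nsets {..<N'} r"
    then obtain T where "T \<in> nsets {..<N} (r + 2)" "nsets T r \<subseteq> \<phi>"
      using nsets_mono[OF sub] by auto
    then show False using free unfolding clique_free_def by simp
  qed
  have unmarked': "\<exists>f\<in>nsets D (r - 1). x \<in> f \<and> f \<notin> \<psi>"
    if "D \<subseteq> {..<N'}" "x \<in> D" "q \<le> card D" for D x
    using unmarked[OF subset_trans[OF that(1) sub] that(2,3)] .
  show ?thesis
    using old dense' free' unmarked' unfolding marked_def by simp
qed

lemma g_le_of_marked:
  assumes "marked k N n q \<phi> \<psi>"
  shows "g k N \<le> n"
proof -
  have \<phi>: "\<phi> \<subseteq> nsets {..<N} k" "clique_free k (k + 2) {..<N} \<phi>"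
    and dense: "\<And>S. S \<subseteq> {..<N} \<Longrightarrow> n \<le> card S \<Longrightarrow> \<exists>T\<in>nsets S (k + 1). nsets T k \<subseteq> \<phi>"
    using assms unfolding marked_def by simp_all
  obtain S where S: "s_independent k (k + 1) {..<N} \<phi> S" "card S = alpha k (k + 1) {..<N} \<phi>"
    using alpha_attained[of "{..<N}" "k + 1" k \<phi>] by auto
  have "card S < n"
  proof (rule ccontr)
    assume "\<not> card S < n"
    then obtain T where T: "T \<in> nsets S (k + 1)" "nsets T k \<subseteq> \<phi>"
      using dense[of S] S(1) by (auto simp: s_independent_def)
    then have "nsets T k \<subseteq> induced_edges \<phi> S"
      by (auto simp: induced_edges_def nsets_def)
    then show False
      using S(1) T(1) by (auto simp: s_independent_def clique_free_def)
  qed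
  moreover have "g k N \<le> alpha k (k + 1) {..<N} \<phi>"
    unfolding g_def erdos_rogers_def
  proof (rule cInf_lower)
    have "kgraph k {..<N} \<phi>" "card {..<N} = N" using \<phi>(1) by (simp_all add: kgraph_def)
    with \<phi>(2) show "alpha k (k + 1) {..<N} \<phi> \<in> {alpha k (k + 1) V E | (V :: nat set) E.
        kgraph k V E \<and> card V = N \<and> clique_free k (k + 2) V E}"
      by blast
  qed simp
  ultimately show ?thesis using S(2) by simp
qed

lemma iter_log_Suc: "iter_log (Suc i) x = log 2 (iter_log i x)"
  by (simp add: iter_log_def)

lemma iter_log_Suc': "iter_log (Suc i) x = iter_log i (log 2 x)"
  by (simp add: iter_log_def funpow_swap1)

lemma log2_at_top: "filterlim (log 2) at_top (at_top :: real filter)"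
proof -
  have "filterlim (\<lambda>x :: real. ln x * (1 / ln 2)) at_top at_top"
    by (rule filterlim_at_top_mult_tendsto_pos[OF tendsto_const _ ln_at_top]) simp
  then show ?thesis by (simp add: log_def[abs_def])
qed

lemma iter_log_at_top: "filterlim (iter_log i) at_top at_top"
proof (induction i)
  case 0
  then show ?case by (simp add: iter_log_def filterlim_ident)
next
  case (Suc i)
  then show ?case
    using filterlim_compose[OF log2_at_top Suc] by (simp add: iter_log_Suc[abs_def])
qed

lemma iter_log_ge_1: "eventually (\<lambda>x. 1 \<le> iter_log i x) at_top"
  using iter_log_at_top[of i] by (simp add: filterlim_at_top)

text \<open>
  Rounding \<open>log N\<close> up to an integer changes the argument by at most \<open>1\<close>. From some point on every
  further logarithm keeps the effect at most \<open>1\<close>, as \<open>log 2 (z + 1) \<le> log 2 (2 * z)\<close> for \<open>z \<ge> 1\<close>.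
\<close>

lemma iter_log_unit_shift:
  "eventually (\<lambda>x. \<forall>y. x \<le> y \<longrightarrow> y \<le> x + 1 \<longrightarrow>
     iter_log i x \<le> iter_log i y \<and> iter_log i y \<le> iter_log i x + 1) at_top"
proof (induction i)
  case 0
  then show ?case by (simp add: iter_log_def)
next
  case (Suc i)
  show ?case
    using Suc iter_log_ge_1[of i]
  proof eventually_elim
    case (elim x)
    show ?case
    proof (intro allI impI)
      fix y assume "x \<le> y" "y \<le> x + 1"
      with elim have *: "1 \<le> iter_log i x" "iter_log i x \<le> iter_log i y" "iter_log i y \<le> iter_log i x + 1"
        by auto
      then have "log 2 (iter_log i y) \<le> log 2 (2 * iter_log i x)" by simp
      also have "\<dots> = log 2 (iter_log i x) + 1" using *(1) by (simp add: log_mult)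
      finally show "iter_log (Suc i) x \<le> iter_log (Suc i) y \<and> iter_log (Suc i) y \<le> iter_log (Suc i) x + 1"
        using * by (simp add: iter_log_Suc)
    qed
  qed
qed

text \<open>
  For given \<open>N\<close> the step is applied with \<open>M = \<lceil>log 2 N\<rceil>\<close>, and the result is restricted to \<open>N\<close> of the
  \<open>2 ^ M\<close> vertices.
\<close>

lemma marked_exists:
  "\<exists>q. \<exists>C>0. eventually (\<lambda>N. \<forall>n. C * iter_log (Suc i) (real N) \<le> real n \<longrightarrow>
     (\<exists>\<phi> \<psi>. marked (i + 4) N n q \<phi> \<psi>)) sequentially"
proof (induction i)
  case 0
  obtain K where K: "0 < K" "\<forall>N\<ge>2. \<forall>n. K * log 2 (real N) \<le> real n \<longrightarrow> (\<exists>\<phi> \<psi>. marked 4 N n 6 \<phi> \<psi>)"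
    using marked_base[of 4] by auto
  have "eventually (\<lambda>N. \<forall>n. K * iter_log (Suc 0) (real N) \<le> real n \<longrightarrow>
     (\<exists>\<phi> \<psi>. marked (0 + 4) N n 6 \<phi> \<psi>)) sequentially"
    using eventually_ge_at_top[of 2] by eventually_elim (use K(2) in \<open>simp add: iter_log_def\<close>)
  then show ?case using K(1) by blast
next
  case (Suc i)
  then obtain q C where C: "0 < C" and ev: "eventually (\<lambda>N. \<forall>n. C * iter_log (Suc i) (real N) \<le> real n \<longrightarrow>
     (\<exists>\<phi> \<psi>. marked (i + 4) N n q \<phi> \<psi>)) sequentially" by blast
  define Q where "Q = (2::real) ^ q"
  have Q: "0 < Q" by (simp add: Q_def)
  let ?M = "\<lambda>N. nat \<lceil>log 2 (real N)\<rceil>"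
  have log_N: "filterlim (\<lambda>N. log 2 (real N)) at_top sequentially"
    by (rule filterlim_compose[OF log2_at_top filterlim_real_sequentially])
  from ev obtain M0 where "\<forall>M\<ge>M0. \<forall>n. C * iter_log (Suc i) (real M) \<le> real n \<longrightarrow>
      (\<exists>\<phi> \<psi>. marked (i + 4) M n q \<phi> \<psi>)"
    unfolding eventually_sequentially by (elim exE)
  then have M0: "\<exists>\<phi> \<psi>. marked (i + 4) M n q \<phi> \<psi>"
    if "M0 \<le> M" "C * iter_log (Suc i) (real M) \<le> real n" for M n
    using that by simp
  have "eventually (\<lambda>N. real M0 \<le> log 2 (real N)) sequentially"
    using log_N by (simp add: filterlim_at_top)
  moreover have "eventually (\<lambda>N. 1 \<le> iter_log (Suc i) (log 2 (real N))) sequentially"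
    by (rule eventually_compose_filterlim[OF iter_log_ge_1 log_N])
  moreover have "eventually (\<lambda>N. \<forall>y. log 2 (real N) \<le> y \<longrightarrow> y \<le> log 2 (real N) + 1 \<longrightarrow>
     iter_log (Suc i) (log 2 (real N)) \<le> iter_log (Suc i) y \<and>
     iter_log (Suc i) y \<le> iter_log (Suc i) (log 2 (real N)) + 1) sequentially"
    by (rule eventually_compose_filterlim[OF iter_log_unit_shift log_N])
  ultimately have "eventually (\<lambda>N. \<forall>n. (Q * (2 * C + 1) + 1) * iter_log (Suc (Suc i)) (real N) \<le> real n \<longrightarrow>
     (\<exists>\<phi> \<psi>. marked (Suc i + 4) N n (2 ^ q) \<phi> \<psi>)) sequentially"
    using eventually_ge_at_top[of 1]
  proof eventually_elim
    case (elim N)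
    define L where "L = iter_log (Suc i) (log 2 (real N))"
    have L: "1 \<le> L" using elim(2) by (simp add: L_def)
    have pos: "0 \<le> log 2 (real N)" using elim(4) by simp
    have M: "log 2 (real N) \<le> real (?M N)" "real (?M N) \<le> log 2 (real N) + 1"
      using pos by linarith+
    have "M0 \<le> ?M N" using elim(1) M(1) by linarith
    define n0 where "n0 = nat \<lceil>C * iter_log (Suc i) (real (?M N))\<rceil>"
    have "C * iter_log (Suc i) (real (?M N)) \<le> real n0" unfolding n0_def by (rule real_nat_ceiling_ge)
    then obtain \<phi> \<psi> where "marked (i + 4) (?M N) n0 q \<phi> \<psi>" using M0[OF \<open>M0 \<le> ?M N\<close>] by blast
    then have step: "marked (Suc (i + 4)) (2 ^ ?M N) (2 ^ q * n0 + 1) (2 ^ q)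
        (step_edges (i + 4) (?M N) \<phi> \<psi>) (step_marks \<psi>)"
      by (intro marked_step) auto
    have "L \<le> iter_log (Suc i) (real (?M N))" and le: "iter_log (Suc i) (real (?M N)) \<le> L + 1"
      using elim(3) M by (auto simp: L_def)
    then have "0 \<le> C * iter_log (Suc i) (real (?M N))" using L C by simp
    then have "real n0 \<le> C * iter_log (Suc i) (real (?M N)) + 1" unfolding n0_def by linarith
    also have "\<dots> \<le> C * (L + 1) + 1" using le C by simp
    also have "\<dots> \<le> (2 * C + 1) * L"
    proof -
      have "C * 1 \<le> C * L" using L C by (intro mult_left_mono) auto
      then show ?thesis using L by (simp add: algebra_simps)
    qed
    finally have n0: "Q * real n0 \<le> Q * ((2 * C + 1) * L)" using Q by simp
    have "real (2 ^ q * n0 + 1) = Q * real n0 + 1" by (simp add: Q_def)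
    also have "\<dots> \<le> (Q * (2 * C + 1) + 1) * L"
      using n0 L by (simp add: distrib_right mult.assoc)
    finally have bound: "real (2 ^ q * n0 + 1) \<le> (Q * (2 * C + 1) + 1) * L" .
    have "real N = 2 powr (log 2 (real N))" using elim(4) by simp
    also have "\<dots> \<le> 2 powr (real (?M N))" using M(1) by (intro powr_mono) auto
    also have "\<dots> = real (2 ^ ?M N)" by (simp add: powr_realpow)
    finally have "N \<le> 2 ^ ?M N" by (simp only: of_nat_le_iff)
    show ?case
    proof (intro allI impI)
      fix n assume "(Q * (2 * C + 1) + 1) * iter_log (Suc (Suc i)) (real N) \<le> real n"
      then have "real (2 ^ q * n0 + 1) \<le> real n" using bound by (simp add: iter_log_Suc'[of "Suc i"] L_def)
      then have "2 ^ q * n0 + 1 \<le> n" by (simp only: of_nat_le_iff)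
      from marked_mono[OF step \<open>N \<le> 2 ^ ?M N\<close> this]
      show "\<exists>\<phi> \<psi>. marked (Suc i + 4) N n (2 ^ q) \<phi> \<psi>" by auto
    qed
  qed
  moreover have "0 < Q * (2 * C + 1) + 1" using Q C by (simp add: add_pos_pos)
  ultimately show ?case by blast
qed

theorem theorem4p4:
  fixes k :: nat
  assumes "k \<ge> 5"
  shows "(\<lambda>N. real (g k N)) \<in> O(\<lambda>N. iter_log (k - 3) (real N))"
proof -
  define i where "i = k - 4"
  have k: "k = i + 4" "k - 3 = Suc i" using assms by (auto simp: i_def)
  obtain q C where C: "0 < C" and ev: "eventually (\<lambda>N. \<forall>n. C * iter_log (Suc i) (real N) \<le> real n \<longrightarrow>
     (\<exists>\<phi> \<psi>. marked k N n q \<phi> \<psi>)) sequentially"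
    using marked_exists[of i] unfolding k(1) by blast
  have "eventually (\<lambda>N. 1 \<le> iter_log (Suc i) (real N)) sequentially"
    by (rule eventually_compose_filterlim[OF iter_log_ge_1 filterlim_real_sequentially])
  with ev have "eventually (\<lambda>N. norm (real (g k N)) \<le> (C + 1) * norm (iter_log (k - 3) (real N))) sequentially"
  proof eventually_elim
    case (elim N)
    define n where "n = nat \<lceil>C * iter_log (Suc i) (real N)\<rceil>"
    have "C * iter_log (Suc i) (real N) \<le> real n" unfolding n_def by (rule real_nat_ceiling_ge)
    then have "g k N \<le> n" using elim(1) g_le_of_marked by blast
    moreover have "0 \<le> C * iter_log (Suc i) (real N)" using elim(2) C by simp
    then have "real n \<le> C * iter_log (Suc i) (real N) + 1" unfolding n_def by linarith
    ultimately have "real (g k N) \<le> (C + 1) * iter_log (Suc i) (real N)"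
      using elim(2) by (simp add: distrib_right)
    then show ?case using elim(2) by (simp add: k(2))
  qed
  then show ?thesis by (rule bigoI)
qed

end
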